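(* Let $\varphi$ be an Orlicz function. (i) Let $w$ be a positive decreasing weight function on $I=(0,\infty)$ that is $\varphi$-controlled. Then for every $f\in L^0$, $$\int_0^\infty \varphi\left(\frac{f^*}{w}\right) w = \inf\left\{\int_0^\infty \varphi\left(\frac{|f|}{v}\right) v : v\sim w,\ v>0\right\} = \inf\left\{\int_0^\infty \varphi\left(\frac{|f|}{w\circ\sigma}\right) w\circ\sigma : \sigma \text{ a measure preserving mapping from } I \text{ to } I\right\}.$$ (ii) Let $w=\{w(n)\}$ be a positive decreasing weight sequence that is $\varphi$-controlled. Then for any real sequence $x=\{x(n)\}$, $$\sum_{n=1}^\infty \varphi\left(\frac{x^*(n)}{w(n)}\right) w(n) = \inf\left\{\sum_{n=1}^\infty \varphi\left(\frac{|x(n)|}{v(n)}\right) v(n) : v\sim w,\ v>0\right\} = \inf\left\{\sum_{n=1}^\infty \varphi\left(\frac{|x(n)|}{w\circ\sigma(n)}\right) w\circ\sigma(n) : \sigma \text{ an automorphism of } \mathbb{N}\right\}.$$ If $w$ is a positive decreasing weight function on $I=(0,\infty)$, not necessarily $\varphi$-controlled, then for every $f\in L^0$ with $M(D_2f)<\infty$, $$\int_0^\infty \varphi\left(\frac{f^*}{w}\right) w = \inf\left\{\int_0^\infty \varphi\left(\frac{|f|}{v}\right) v : v\sim w,\ v>0\right\} = \inf\left\{\int_0^\infty \varphi\left(\frac{|f|}{w\circ\sigma}\right) w\circ\sigma : \sigma \text{ a measure preserving mapping from } I \text{ to } I\right\}.$$ Respectively, if $w=\{w(n)\}$ is a positive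 decreasing weight sequence, not necessarily $\varphi$-controlled, then for every real sequence $x=\{x(n)\}$ with $m(D_2x)<\infty$, $$\sum_{n=1}^\infty \varphi\left(\frac{x^*(n)}{w(n)}\right) w(n) = \inf\left\{\sum_{n=1}^\infty \varphi\left(\frac{|x(n)|}{v(n)}\right) v(n) : v\sim w,\ v>0\right\} = \inf\left\{\sum_{n=1}^\infty \varphi\left(\frac{|x(n)|}{w\circ\sigma(n)}\right) w\circ\sigma(n) : \sigma \text{ an automorphism of } \mathbb{N}\right\}.$$
   Context: An Orlicz function is a convex, strictly increasing $\varphi:\mathbb{R}_+\to\mathbb{R}_+$ with $\varphi(0)=0$. "Decreasing" means non-increasing. $L^0$ is the set of Lebesgue measurable $f:I\to\mathbb{R}$, $I=(0,\infty)$. For $f\in L^0$, $d_f(s)=|\{t\in I:|f(t)|>s\}|$ (Lebesgue measure) and $f^*(t)=\inf\{s\ge0:d_f(s)\le t\}$. For a sequence $x$, $d_x(s)=|\{k\in\mathbb{N}:|x(k)|>s\}|$ (cardinality) and $x^*(n)=\inf\{s>0:d_x(s)\le n-1\}$ ($\inf\emptyset=\infty$). $f\sim g$ means $f^*=g^*$, and similarly for sequences. A weight function (sequence) is a non-negative decreasing real-valued function (sequence). $\varphi$-controlled: a positive weight function $w$ (resp. sequence) is $\varphi$-controlled if there is $K>0$ such that for every $c>0$ and every $t\in I$ with $2t\in I$ (resp. every $n\in\mathbb{N}$), $\varphi(c/w(2t))w(2t)\le K\varphi(c/w(t))w(t)$ (resp. $\varphi(c/w(2n))w(2n)\le K\varphi(c/w(n))w(n)$).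 A map $\sigma:I\to I$ is measure preserving if $\sigma^{-1}(A)$ is measurable with $|\sigma^{-1}(A)|=|A|$ for every measurable $A\subset I$; an automorphism of $\mathbb{N}$ is a bijection $\mathbb{N}\to\mathbb{N}$. $M(f)=\int_I\varphi(f^*/w)w$, $m(x)=\sum_{n=1}^\infty\varphi(x^*(n)/w(n))w(n)$, with values in $[0,\infty]$ (the integrand or summand is $\infty$ where $f^*$ or $x^*$ is $\infty$). $D_2f(t)=f(t/2)$ and $D_2x(n)=x(\lceil n/2\rceil)$. *)

theory Defs
  imports "HOL-Analysis.Analysis"
begin

definition orlicz_function :: "(real \<Rightarrow> real) \<Rightarrow> bool" where
  "orlicz_function \<phi> \<longleftrightarrow>
     \<phi> ` {0..} \<subseteq> {0..} \<and> convex_on {0..} \<phi> \<and> strict_mono_on {0..} \<phi> \<and> \<phi> 0 = 0"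

text \<open>
  The perspective \<open>\<phi> (a / b) b\<close> for \<open>b > 0\<close>, with value \<open>\<infinity>\<close> at \<open>a = \<infinity>\<close>; the first argument is
  extended because decreasing rearrangements may be infinite.
\<close>
definition orlicz_term :: "(real \<Rightarrow> real) \<Rightarrow> ennreal \<Rightarrow> real \<Rightarrow> ennreal" where
  "orlicz_term \<phi> a b = (if a = \<infinity> then \<infinity> else ennreal (\<phi> (enn2real a / b) * b))"

text \<open>
  A function on \<open>I\<close> is a function on \<^typ>\<open>real\<close> whose values outside \<open>I\<close> are irrelevant.
\<close>

abbreviation I :: "real set" where
  "I \<equiv> {0<..}"

abbreviation L0 :: "(real \<Rightarrow> real) set" where
  "L0 \<equiv> borel_measurable (lebesgue_on I)"

definition fun_distr :: "(real \<Rightarrow> real) \<Rightarrow> real \<Rightarrow> ennreal" where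
  "fun_distr f s = emeasure lebesgue {t \<in> I. s < \<bar>f t\<bar>}"

definition fun_rearr :: "(real \<Rightarrow> real) \<Rightarrow> real \<Rightarrow> ennreal" where
  "fun_rearr f t = Inf {ennreal s |s. 0 \<le> s \<and> fun_distr f s \<le> ennreal t}"

definition fun_equidistr :: "(real \<Rightarrow> real) \<Rightarrow> (real \<Rightarrow> real) \<Rightarrow> bool" where
  "fun_equidistr f g \<longleftrightarrow> (\<forall>t\<in>I. fun_rearr f t = fun_rearr g t)"

definition pos_weight_fun :: "(real \<Rightarrow> real) \<Rightarrow> bool" where
  "pos_weight_fun w \<longleftrightarrow> (\<forall>t\<in>I. 0 < w t) \<and> antimono_on I w"

definition fun_controlled :: "(real \<Rightarrow> real) \<Rightarrow> (real \<Rightarrow> real) \<Rightarrow> bool" where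
  "fun_controlled \<phi> w \<longleftrightarrow>
     (\<exists>K>0. \<forall>c>0. \<forall>t\<in>I. 2 * t \<in> I \<longrightarrow>
        \<phi> (c / w (2 * t)) * w (2 * t) \<le> K * (\<phi> (c / w t) * w t))"

definition measure_preserving_map :: "(real \<Rightarrow> real) \<Rightarrow> bool" where
  "measure_preserving_map \<sigma> \<longleftrightarrow>
     \<sigma> ` I \<subseteq> I \<and>
     (\<forall>A\<in>sets lebesgue. A \<subseteq> I \<longrightarrow>
        \<sigma> -` A \<inter> I \<in> sets lebesgue \<and> emeasure lebesgue (\<sigma> -` A \<inter> I) = emeasure lebesgue A)"

definition fun_M :: "(real \<Rightarrow> real) \<Rightarrow> (real \<Rightarrow> real) \<Rightarrow> (real \<Rightarrow> real) \<Rightarrow> ennreal" where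
  "fun_M \<phi> w f = (\<integral>\<^sup>+t\<in>I. orlicz_term \<phi> (fun_rearr f t) (w t) \<partial>lebesgue)"

definition fun_integral :: "(real \<Rightarrow> real) \<Rightarrow> (real \<Rightarrow> real) \<Rightarrow> (real \<Rightarrow> real) \<Rightarrow> ennreal" where
  "fun_integral \<phi> v f = (\<integral>\<^sup>+t\<in>I. ennreal (\<phi> (\<bar>f t\<bar> / v t) * v t) \<partial>lebesgue)"

definition fun_D2 :: "(real \<Rightarrow> real) \<Rightarrow> real \<Rightarrow> real" where
  "fun_D2 f t = f (t / 2)"

text \<open>
  Sequences are indexed by \<open>{1..}\<close>; the value at \<open>0\<close> is irrelevant.
\<close>

definition seq_distr :: "(nat \<Rightarrow> real) \<Rightarrow> real \<Rightarrow> ennreal" where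
  "seq_distr x s = emeasure (count_space {1..}) {k \<in> {1..}. s < \<bar>x k\<bar>}"

definition seq_rearr :: "(nat \<Rightarrow> real) \<Rightarrow> nat \<Rightarrow> ennreal" where
  "seq_rearr x n = Inf {ennreal s |s. 0 < s \<and> seq_distr x s \<le> of_nat (n - 1)}"

definition seq_equidistr :: "(nat \<Rightarrow> real) \<Rightarrow> (nat \<Rightarrow> real) \<Rightarrow> bool" where
  "seq_equidistr x y \<longleftrightarrow> (\<forall>n\<ge>1. seq_rearr x n = seq_rearr y n)"

definition pos_weight_seq :: "(nat \<Rightarrow> real) \<Rightarrow> bool" where
  "pos_weight_seq w \<longleftrightarrow> (\<forall>n\<ge>1. 0 < w n) \<and> antimono_on {1..} w"

definition seq_controlled :: "(real \<Rightarrow> real) \<Rightarrow> (nat \<Rightarrow> real) \<Rightarrow> bool" where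
  "seq_controlled \<phi> w \<longleftrightarrow>
     (\<exists>K>0. \<forall>c>0. \<forall>n\<ge>1.
        \<phi> (c / w (2 * n)) * w (2 * n) \<le> K * (\<phi> (c / w n) * w n))"

definition seq_m :: "(real \<Rightarrow> real) \<Rightarrow> (nat \<Rightarrow> real) \<Rightarrow> (nat \<Rightarrow> real) \<Rightarrow> ennreal" where
  "seq_m \<phi> w x = (\<Sum>n. orlicz_term \<phi> (seq_rearr x (Suc n)) (w (Suc n)))"

definition seq_sum :: "(real \<Rightarrow> real) \<Rightarrow> (nat \<Rightarrow> real) \<Rightarrow> (nat \<Rightarrow> real) \<Rightarrow> ennreal" where
  "seq_sum \<phi> v x = (\<Sum>n. ennreal (\<phi> (\<bar>x (Suc n)\<bar> / v (Suc n)) * v (Suc n)))"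

definition seq_D2 :: "(nat \<Rightarrow> real) \<Rightarrow> nat \<Rightarrow> real" where
  "seq_D2 x n = x (nat \<lceil>real n / 2\<rceil>)"

end

theory Submission
  imports Defs
begin

text \<open>
  Write \<open>H a b = \<phi> (a / b) b\<close>. Since \<open>\<phi>\<close> is convex, the increments of \<open>H\<close> in \<open>a\<close> decrease in \<open>b\<close>.
  Slicing \<open>H\<close> along a fine grid in \<open>a\<close> and using the layer cake formula for each increment bounds the
  integral of \<open>H \<bar>f\<bar> v\<close> below in terms of the measures of the sets \<open>{s < \<bar>f\<bar>, v \<le> b}\<close>. These are least when
  \<open>f\<close> and \<open>v\<close> are similarly ordered, i.e. for \<open>f*\<close> and \<open>w\<close>.

  For the upper bound, one would like to put \<open>w\<close> on the support of \<open>f\<close> in the order of decreasing \<open>\<bar>f\<bar>\<close>, but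
  then nothing may be left for the zeros of \<open>f\<close>. So this is done only up to a large time, after which the
  zeros are interleaved; this at most doubles the remaining ranks. The cost is a tail of the integral of
  \<open>H (f* t) (w (2 t))\<close>, which is finite if \<open>w\<close> is controlled or if \<open>M (D\<^sub>2 f) < \<infinity>\<close>.
\<close>

subsection \<open>Perspectives of Orlicz functions\<close>

text \<open>The infima close up in a circle: \<open>w \<circ> \<sigma>\<close> is equidistributed
  with \<open>w\<close>, so the infimum over \<open>v\<close> is at most the one over \<sigma>, and
  only the comparisons with \<open>M f\<close> take work. Doubling a rank replaces
  \<open>w t\<close> by \<open>w (2 t)\<close>, and this is the origin of both finiteness
  conditions: control bounds \<open>H a (w (2 t))\<close> by \<open>K\<close> times
  \<open>H a (w t)\<close>, and a substitution turns \<open>M (D\<^sub>2 f)\<close> into twice the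
  integral of \<open>H (f* t) (w (2 t))\<close>. Once that integral is finite, starting late makes
  its tail, and hence the error, as small as desired. The same finiteness forces the superlevel sets
  of \<open>|f|\<close> at positive levels to have finite measure, without which ranks in decreasing
  order would make no sense. If \<open>M f\<close> is infinite, the lower bound alone gives
  equality; so the tail integral has to be finite only when \<open>M f\<close> is, which is just
  what control can supply.\<close>

locale orlicz =
  fixes \<phi> :: "real \<Rightarrow> real"
  assumes orlicz: "orlicz_function \<phi>"
begin

lemma phi_0: "\<phi> 0 = 0"
  using orlicz by (simp add: orlicz_function_def)

lemma phi_nonneg: "0 \<le> x \<Longrightarrow> 0 \<le> \<phi> x"
  using orlicz by (auto simp: orlicz_function_def)

lemma phi_less: "0 \<le> x \<Longrightarrow> x < y \<Longrightarrow> \<phi> x < \<phi> y"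
  using orlicz by (auto simp: orlicz_function_def strict_mono_on_def)

lemma phi_mono: "0 \<le> x \<Longrightarrow> x \<le> y \<Longrightarrow> \<phi> x \<le> \<phi> y"
  using phi_less[of x y] by (cases "x = y") auto

lemma phi_convex: "convex_on {0..} \<phi>"
  using orlicz by (simp add: orlicz_function_def)

lemma phi_continuous: "continuous_on {0<..} \<phi>"
proof (rule convex_on_continuous)
  show "convex_on {0<..} \<phi>"
    by (rule convex_on_subset[OF phi_convex]) auto
qed auto

text \<open>The chord over \<open>[x, y']\<close> is intermediate: moving first the right end and
  then the left end to the right can only raise the slope of a convex function.\<close>

lemma phi_slope_mono:
  assumes "0 \<le> x" "x < y" "x \<le> x'" "y \<le> y'" "x' < y'"
  shows "(\<phi> y - \<phi> x) / (y - x) \<le> (\<phi> y' - \<phi> x') / (y' - x')"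
proof -
  have "(\<phi> y - \<phi> x) / (y - x) \<le> (\<phi> y' - \<phi> x) / (y' - x)"
  proof (cases "y = y'")
    case False
    then have "(\<phi> x - \<phi> y) / (x - y) \<le> (\<phi> x - \<phi> y') / (x - y')"
      using assms by (intro convex_on_slope_le(1)[OF phi_convex]) auto
    then show ?thesis
      by (metis minus_diff_eq minus_divide_divide)
  qed simp
  also have "\<dots> \<le> (\<phi> y' - \<phi> x') / (y' - x')"
  proof (cases "x = x'")
    case False
    then have "(\<phi> x - \<phi> y') / (x - y') \<le> (\<phi> x' - \<phi> y') / (x' - y')"
      using assms by (intro convex_on_slope_le(2)[OF phi_convex]) auto
    then show ?thesis
      by (metis minus_diff_eq minus_divide_divide)
  qed simp
  finally show ?thesis .
qed

text \<open>Dividing by \<open>a' - a\<close> turns the increment into the slope of \<phi> over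
  \<open>[a / b, a' / b]\<close>. A larger \<open>b\<close> moves both end points to the left, so
  convexity lowers the slope. This submodularity is what makes similarly ordered arrangements
  cheapest.\<close>

lemma phi_increment_antimono:
  assumes "0 \<le> a" "a \<le> a'" "0 < b" "b \<le> b'"
  shows "\<phi> (a' / b') * b' - \<phi> (a / b') * b' \<le> \<phi> (a' / b) * b - \<phi> (a / b) * b"
proof (cases "a = a'")
  case False
  with assms have less: "a < a'" by simp
  have "(\<phi> (a' / b') - \<phi> (a / b')) / (a' / b' - a / b') \<le> (\<phi> (a' / b) - \<phi> (a / b)) / (a' / b - a / b)"
    using assms less by (intro phi_slope_mono) (auto intro: divide_left_mono divide_strict_right_mono)
  moreover have "(\<phi> (a' / c) - \<phi> (a / c)) / (a' / c - a / c) = (\<phi> (a' / c) * c - \<phi> (a / c) * c) / (a' - a)"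
    if "0 < c" for c
    using that less by (simp add: field_simps)
  ultimately show ?thesis
    using assms less by (simp add: divide_le_cancel)
qed simp

section \<open>The perspective with an extended first argument\<close>

lemma term_0 [simp]: "orlicz_term \<phi> 0 b = 0"
  by (simp add: orlicz_term_def phi_0)

lemma term_ennreal [simp]: "0 \<le> a \<Longrightarrow> orlicz_term \<phi> (ennreal a) b = ennreal (\<phi> (a / b) * b)"
  by (simp add: orlicz_term_def)

lemma term_top [simp]: "orlicz_term \<phi> top b = top"
  by (simp add: orlicz_term_def infinity_ennreal_def)

lemma term_mono:
  assumes "a \<le> a'" "0 < b"
  shows "orlicz_term \<phi> a b \<le> orlicz_term \<phi> a' b"
proof (cases a')
  case (real r')
  with assms obtain r where r: "a = ennreal r" "0 \<le> r" "r \<le> r'"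
    by (cases a) (auto simp: top_unique)
  with real assms show ?thesis
    by (auto intro!: ennreal_leI mult_right_mono phi_mono divide_right_mono)
qed (use assms in auto)

text \<open>As \<phi> vanishes at 0, the value at \<open>a\<close> is the increment from 0 to
  \<open>a\<close>, and such increments decrease in \<open>b\<close>.\<close>

lemma term_antimono:
  assumes "0 < b" "b \<le> b'"
  shows "orlicz_term \<phi> a b' \<le> orlicz_term \<phi> a b"
proof (cases a)
  case (real r)
  then show ?thesis
    using phi_increment_antimono[of 0 r b b'] assms by (auto simp: phi_0 intro!: ennreal_leI)
qed auto

lemma term_pos:
  assumes "0 < a" "0 < b"
  shows "0 < orlicz_term \<phi> a b"
proof (cases a)
  case (real r)
  with assms show ?thesis
    using phi_less[of 0 "r / b"] by (auto simp: phi_0 ennreal_less_zero_iff)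
qed auto

lemma measurable_term [measurable]:
  assumes [measurable]: "f \<in> borel_measurable M" "v \<in> borel_measurable M"
    and pos: "\<And>x. x \<in> space M \<Longrightarrow> 0 < v x"
  shows "(\<lambda>x. orlicz_term \<phi> (f x) (v x)) \<in> borel_measurable M"
proof -
  \<comment> \<open>\<phi> is known to be monotone only on the nonnegative axis; composing with
    \<open>max 0\<close> gives a function that is monotone on the whole line, hence Borel, and
    agrees with \<phi> wherever it is evaluated.\<close>
  have [measurable]: "(\<lambda>x. \<phi> (max 0 x)) \<in> borel_measurable borel"
    by (rule borel_measurable_mono) (auto simp: mono_def intro!: phi_mono)
  have "(\<lambda>x. if f x = top then top else ennreal (\<phi> (max 0 (enn2real (f x) / v x)) * v x)) \<in> borel_measurable M"
    by measurable
  moreover have "orlicz_term \<phi> (f x) (v x) = (if f x = top then top else ennreal (\<phi> (max 0 (enn2real (f x) / v x)) * v x))"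
    if "x \<in> space M" for x
    using pos[OF that] by (auto simp: orlicz_term_def infinity_ennreal_def max_def divide_less_0_iff not_le)
  ultimately show ?thesis
    by (simp cong: measurable_cong)
qed

text \<open>Grid points are compared strictly with \<open>a\<close>, so that integrals of \<open>term_grid\<close> only see superlevel
  sets \<open>{s < f}\<close>, whose measure is right continuous in \<open>s\<close>.\<close>

definition term_increment :: "real \<Rightarrow> nat \<Rightarrow> real \<Rightarrow> ennreal" where
  "term_increment \<delta> i b = ennreal (\<phi> (real (Suc i) * \<delta> / b) * b - \<phi> (real i * \<delta> / b) * b)"

definition term_grid :: "real \<Rightarrow> ennreal \<Rightarrow> real \<Rightarrow> ennreal" where
  "term_grid \<delta> a b = (\<Sum>i. term_increment \<delta> i b * indicator {ennreal (real (Suc i) * \<delta>)<..} a)"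

lemma term_increment_antimono:
  assumes "0 < \<delta>" "0 < b" "b \<le> b'"
  shows "term_increment \<delta> i b' \<le> term_increment \<delta> i b"
  unfolding term_increment_def
  using assms by (intro ennreal_leI phi_increment_antimono) (auto intro: mult_right_mono)

lemma sum_term_increment:
  assumes "0 < \<delta>" "0 < b"
  shows "(\<Sum>i<n. term_increment \<delta> i b) = orlicz_term \<phi> (ennreal (real n * \<delta>)) b"
proof -
  have "(\<Sum>i<n. term_increment \<delta> i b) = ennreal (\<Sum>i<n. \<phi> (real (Suc i) * \<delta> / b) * b - \<phi> (real i * \<delta> / b) * b)"
    unfolding term_increment_def
  proof (rule sum_ennreal)
    fix i
    have "\<phi> (real i * \<delta> / b) \<le> \<phi> (real (Suc i) * \<delta> / b)"
      using assms by (intro phi_mono divide_right_mono mult_right_mono) auto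
    then show "0 \<le> \<phi> (real (Suc i) * \<delta> / b) * b - \<phi> (real i * \<delta> / b) * b"
      using assms by simp
  qed
  also have "(\<Sum>i<n. \<phi> (real (Suc i) * \<delta> / b) * b - \<phi> (real i * \<delta> / b) * b) = \<phi> (real n * \<delta> / b) * b"
    using sum_lessThan_telescope[of "\<lambda>i. \<phi> (real i * \<delta> / b) * b" n] by (simp add: phi_0)
  finally show ?thesis
    using assms by simp
qed

text \<open>The grid points strictly below \<open>a\<close> form an initial segment, so the active
  increments telescope to the perspective at \<open>m * \<delta>\<close>, which is at most
  \<open>a\<close>: the grid rounds \<open>a\<close> down.\<close>

lemma term_grid_le:
  assumes "0 < \<delta>" "0 < b"
  shows "term_grid \<delta> a b \<le> orlicz_term \<phi> a b"
  unfolding term_grid_def suminf_eq_SUP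
proof (rule SUP_least)
  fix n
  define m where "m = card {i. i < n \<and> ennreal (real (Suc i) * \<delta>) < a}"
  have "{i. i < n \<and> ennreal (real (Suc i) * \<delta>) < a} = {..<m} \<and> (m > 0 \<longrightarrow> ennreal (real m * \<delta>) \<le> a)"
    (is "?P n m")
    unfolding m_def
  proof (induction n)
    case (Suc n)
    let ?S = "\<lambda>n. {i. i < n \<and> ennreal (real (Suc i) * \<delta>) < a}"
    show ?case
    proof (cases "ennreal (real (Suc n) * \<delta>) < a")
      case True
      have "ennreal (real (Suc i) * \<delta>) < a" if "i < n" for i
        using that assms by (intro le_less_trans[OF _ True] ennreal_leI) auto
      then have "?S (Suc n) = {..<Suc n}"
        using True less_Suc_eq by auto
      then show ?thesis
        using True by auto
    next
      case False
      then have "?S (Suc n) = ?S n"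
        using less_Suc_eq by auto
      then show ?thesis
        using Suc by simp
    qed
  qed simp
  then have P: "{i. i < n \<and> ennreal (real (Suc i) * \<delta>) < a} = {..<m}" "ennreal (real m * \<delta>) \<le> a"
    by (cases "m = 0"; simp)+
  have "(\<Sum>i<n. term_increment \<delta> i b * indicator {ennreal (real (Suc i) * \<delta>)<..} a)
      = (\<Sum>i\<in>{i. i < n \<and> ennreal (real (Suc i) * \<delta>) < a}. term_increment \<delta> i b)"
    by (rule sum.mono_neutral_cong_right) (auto simp: indicator_def)
  also have "\<dots> = orlicz_term \<phi> (ennreal (real m * \<delta>)) b"
    unfolding P(1) using assms by (rule sum_term_increment)
  also have "\<dots> \<le> orlicz_term \<phi> a b"
    using P(2) assms by (intro term_mono)
  finally show "(\<Sum>i<n. term_increment \<delta> i b * indicator {ennreal (real (Suc i) * \<delta>)<..} a) \<le> orlicz_term \<phi> a b" .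
qed

text \<open>Rounding \<open>c\<close> up to a grid point \<open>n * \<delta>\<close> costs at most
  \<delta> and stays below \<open>a\<close>; hence all of the first \<open>n\<close> increments are
  active.\<close>

lemma term_grid_ge:
  assumes "0 < \<delta>" "0 < b" "0 \<le> c" "ennreal (c + \<delta>) < a"
  shows "orlicz_term \<phi> (ennreal c) b \<le> term_grid \<delta> a b"
proof -
  define n where "n = nat \<lceil>c / \<delta>\<rceil>"
  have "real_of_int \<lceil>c / \<delta>\<rceil> < c / \<delta> + 1"
    by linarith
  then have n: "c \<le> real n * \<delta>" "real n * \<delta> \<le> c + \<delta>"
    using assms of_nat_ceiling[of "c / \<delta>"] le_of_int_ceiling[of "c / \<delta>"]
    by (auto simp: n_def field_simps divide_le_eq simp del: le_of_int_ceiling)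
  have "orlicz_term \<phi> (ennreal c) b \<le> orlicz_term \<phi> (ennreal (real n * \<delta>)) b"
    using n assms by (intro term_mono ennreal_leI)
  also have "\<dots> = (\<Sum>i<n. term_increment \<delta> i b)"
    using assms by (simp add: sum_term_increment)
  also have "\<dots> = (\<Sum>i<n. term_increment \<delta> i b * indicator {ennreal (real (Suc i) * \<delta>)<..} a)"
  proof (rule sum.cong)
    fix i assume "i \<in> {..<n}"
    then have "real (Suc i) * \<delta> \<le> real n * \<delta>"
      using assms by (intro mult_right_mono) auto
    then have "ennreal (real (Suc i) * \<delta>) \<le> ennreal (c + \<delta>)"
      using n by (intro ennreal_leI) linarith
    then show "term_increment \<delta> i b = term_increment \<delta> i b * indicator {ennreal (real (Suc i) * \<delta>)<..} a"
      using assms(4) by (simp add: indicator_def)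
  qed simp
  also have "\<dots> \<le> term_grid \<delta> a b"
    unfolding term_grid_def by (rule sum_le_suminf) auto
  finally show ?thesis .
qed

text \<open>Left continuity of the perspective in its first argument. At finite \<open>a\<close> it
  comes from continuity of a convex function on the open half-line, at infinity from the growth of
  \<phi>, which is at least linear beyond 1.\<close>

lemma term_lower_approx:
  assumes "y < orlicz_term \<phi> a b" "0 < b"
  obtains c where "0 \<le> c" "ennreal c < a" "y < orlicz_term \<phi> (ennreal c) b"
proof (cases a)
  case (real r)
  then have "r > 0"
    using assms by (cases "r = 0") auto
  have "isCont \<phi> (r / b)"
    using phi_continuous \<open>r > 0\<close> assms(2) by (auto simp: continuous_on_eq_continuous_at)
  moreover have "((\<lambda>c. c / b) \<longlongrightarrow> r / b) (at_left r)"
    using assms(2) by (intro tendsto_intros) auto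
  ultimately have "((\<lambda>c. \<phi> (c / b)) \<longlongrightarrow> \<phi> (r / b)) (at_left r)"
    by (rule isCont_tendsto_compose)
  then have "((\<lambda>c. ennreal (\<phi> (c / b) * b)) \<longlongrightarrow> ennreal (\<phi> (r / b) * b)) (at_left r)"
    by (intro tendsto_ennrealI tendsto_mult tendsto_const)
  then have "\<forall>\<^sub>F c in at_left r. y < ennreal (\<phi> (c / b) * b)"
    using assms real by (intro order_tendstoD) auto
  moreover have "\<forall>\<^sub>F c in at_left r. c \<in> {0<..<r}"
    by (rule eventually_at_leftI[of 0]) (use \<open>r > 0\<close> in auto)
  ultimately have "\<forall>\<^sub>F c in at_left r. c \<in> {0<..<r} \<and> y < ennreal (\<phi> (c / b) * b)"
    by eventually_elim auto
  then obtain c where "0 < c" "c < r" "y < ennreal (\<phi> (c / b) * b)"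
    by (metis (mono_tags, lifting) eventually_happens greaterThanLessThan_iff trivial_limit_at_left_real)
  then show ?thesis
    using real by (intro that[of c]) (auto simp: ennreal_less_iff)
next
  case top
  then have "y < top"
    using assms by simp
  then obtain r where r: "y = ennreal r" "0 \<le> r"
    by (cases y) auto
  \<comment> \<open>Chosen so that \<open>u * \<phi> 1 * b\<close> is
    \<open>r + \<phi> 1 * b\<close> and \<open>u\<close> is at least 1, where convexity bounds
    \<open>\<phi> u\<close> below by \<open>u * \<phi> 1\<close>.\<close>
  define u where "u = r / (\<phi> 1 * b) + 1"
  have "0 < \<phi> 1"
    using phi_less[of 0 1] by (simp add: phi_0)
  then have "1 \<le> u"
    using r assms by (auto simp: u_def)
  then have "u * \<phi> 1 \<le> \<phi> u"
    using phi_slope_mono[of 0 1 0 u] by (simp add: phi_0 field_simps)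
  moreover have "r < u * \<phi> 1 * b"
    using \<open>0 < \<phi> 1\<close> assms by (simp add: u_def field_simps)
  ultimately have "r < \<phi> u * b"
    using assms by (smt (verit) mult_right_mono)
  then show ?thesis
    using top r \<open>1 \<le> u\<close> assms by (intro that[of "u * b"]) (auto simp: ennreal_less_iff)
qed

text \<open>The meshes \<open>1 / (m + 1)\<close> do not refine one another, so the grid sums need
  not increase with \<open>m\<close>. A lower limit is enough, since Fatou's lemma takes care of the
  integrals.\<close>

lemma term_le_liminf_grid:
  assumes "0 < b"
  shows "orlicz_term \<phi> a b \<le> liminf (\<lambda>m. term_grid (1 / real (Suc m)) a b)"
  unfolding le_Liminf_iff
proof (intro allI impI)
  fix y assume "y < orlicz_term \<phi> a b"
  then obtain c where c: "0 \<le> c" "ennreal c < a" "y < orlicz_term \<phi> (ennreal c) b"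
    using assms by (rule term_lower_approx)
  have "(\<lambda>m. ennreal (c + 1 / real (Suc m))) \<longlonglongrightarrow> ennreal (c + 0)"
    by (intro tendsto_intros LIMSEQ_Suc lim_1_over_n)
  then have "\<forall>\<^sub>F m in sequentially. ennreal (c + 1 / real (Suc m)) < a"
    using c by (intro order_tendstoD) auto
  then show "\<forall>\<^sub>F m in sequentially. y < term_grid (1 / real (Suc m)) a b"
  proof eventually_elim
    case (elim m)
    show ?case
      using c term_grid_ge[OF _ assms c(1) elim] by auto
  qed
qed

end

subsection \<open>Comparison of integrals by joint level sets\<close>

lemma sigma_finite_lebesgue_on:
  assumes "A \<in> sets lebesgue"
  shows "sigma_finite_measure (lebesgue_on A)"
proof (rule sigma_finite_measure_restrict_space[OF _ assms])
  show "sigma_finite_measure (lebesgue :: 'a measure)"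
  proof
    show "\<exists>A::'a set set. countable A \<and> A \<subseteq> sets lebesgue \<and> \<Union>A = space lebesgue \<and> (\<forall>a\<in>A. emeasure lebesgue a \<noteq> \<infinity>)"
      by (intro exI[of _ "range (\<lambda>n::nat. cball 0 (real n))"])
        (use emeasure_bounded_finite[OF bounded_cball] in \<open>auto intro: real_arch_simple simp: less_top emeasure_lborel_cball_finite[THEN less_imp_neq]\<close>)
  qed
qed

lemma nn_integral_layer_cake:
  assumes "sigma_finite_measure M" and [measurable]: "h \<in> borel_measurable M"
  shows "(\<integral>\<^sup>+x. h x \<partial>M) = (\<integral>\<^sup>+\<tau>\<in>{0..}. emeasure M {x \<in> space M. ennreal \<tau> < h x} \<partial>lborel)"
proof -
  interpret M: sigma_finite_measure M by fact
  interpret pair_sigma_finite M lborel ..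
  \<comment> \<open>The constraint \<open>0 \<le> \<tau>\<close> matters: \<open>ennreal\<close>
    sends negative reals to 0, so every slice with \<open>a > 0\<close> would otherwise contain the
    negative half-line.\<close>
  have slice: "(\<integral>\<^sup>+\<tau>. of_bool (0 \<le> \<tau> \<and> ennreal \<tau> < a) \<partial>lborel) = a" for a
  proof -
    have "(\<integral>\<^sup>+\<tau>. of_bool (0 \<le> \<tau> \<and> ennreal \<tau> < a) \<partial>lborel)
        = (\<integral>\<^sup>+\<tau>. indicator {\<tau>. 0 \<le> \<tau> \<and> ennreal \<tau> < a} \<tau> \<partial>lborel)"
      by (intro nn_integral_cong) (auto simp: indicator_def)
    also have "\<dots> = emeasure lborel {\<tau>::real. 0 \<le> \<tau> \<and> ennreal \<tau> < a}"
      by (rule nn_integral_indicator) measurable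
    also have "\<dots> = a"
    proof (cases a)
      case (real r)
      then have "{\<tau>. 0 \<le> \<tau> \<and> ennreal \<tau> < a} = {0..<r}"
        by (auto simp: ennreal_less_iff)
      then show ?thesis
        using real by simp
    next
      case top
      then have *: "{\<tau>. 0 \<le> \<tau> \<and> ennreal \<tau> < a} = {0..}"
        by auto
      have "of_nat n \<le> emeasure lborel {0::real..}" for n
        using emeasure_mono[of "{0..real n}" "{0..}" lborel] by (simp add: ennreal_of_nat_eq_real_of_nat)
      then have "emeasure lborel {0::real..} = top"
        by (metis ennreal_SUP_of_nat_eq_top SUP_least top_unique)
      then show ?thesis
        using top * by simp
    qed
    finally show ?thesis .
  qed
  have "(\<integral>\<^sup>+x. h x \<partial>M) = (\<integral>\<^sup>+x. (\<integral>\<^sup>+\<tau>. of_bool (0 \<le> \<tau> \<and> ennreal \<tau> < h x) \<partial>lborel) \<partial>M)"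
    by (simp only: slice)
  also have "\<dots> = (\<integral>\<^sup>+\<tau>. (\<integral>\<^sup>+x. of_bool (0 \<le> \<tau> \<and> ennreal \<tau> < h x) \<partial>M) \<partial>lborel)"
    by (rule Fubini'[symmetric]) measurable
  also have "\<dots> = (\<integral>\<^sup>+\<tau>\<in>{0..}. emeasure M {x \<in> space M. ennreal \<tau> < h x} \<partial>lborel)"
  proof (rule nn_integral_cong)
    fix \<tau> :: real
    have "(\<integral>\<^sup>+x. of_bool (0 \<le> \<tau> \<and> ennreal \<tau> < h x) \<partial>M)
       = (\<integral>\<^sup>+x. indicator {0..} \<tau> * indicator {x \<in> space M. ennreal \<tau> < h x} x \<partial>M)"
      by (intro nn_integral_cong) (auto simp: indicator_def)
    then show "(\<integral>\<^sup>+x. of_bool (0 \<le> \<tau> \<and> ennreal \<tau> < h x) \<partial>M)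
       = emeasure M {x \<in> space M. ennreal \<tau> < h x} * indicator {0..} \<tau>"
      by (simp add: nn_integral_cmult mult.commute)
  qed
  finally show ?thesis .
qed

lemma nn_integral_le_of_levels:
  assumes "sigma_finite_measure M" "sigma_finite_measure N"
    and "h \<in> borel_measurable M" "k \<in> borel_measurable N"
    and "\<And>\<tau>. 0 \<le> \<tau> \<Longrightarrow> emeasure N {y \<in> space N. ennreal \<tau> < k y} \<le> emeasure M {x \<in> space M. ennreal \<tau> < h x}"
  shows "(\<integral>\<^sup>+y. k y \<partial>N) \<le> (\<integral>\<^sup>+x. h x \<partial>M)"
  unfolding nn_integral_layer_cake[OF assms(1,3)] nn_integral_layer_cake[OF assms(2,4)]
  by (intro nn_integral_mono) (auto simp: indicator_def intro: assms(5))

text \<open>Such a set is \<open>(0, c]\<close>, \<open>(0, c)\<close> or the whole half-line.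
  Closed right ends are wanted because the comparison hypotheses speak only of the sets where the
  weight is at most \<open>b\<close>.\<close>

lemma down_set_exhaustion:
  fixes B :: "real set"
  assumes "B \<subseteq> {0<..}" "B \<noteq> {}" and down: "\<And>b c. b \<in> B \<Longrightarrow> 0 < c \<Longrightarrow> c \<le> b \<Longrightarrow> c \<in> B"
  obtains b :: "nat \<Rightarrow> real" where "incseq b" "range b \<subseteq> B" "B = (\<Union>n. {0<..b n})"
proof (cases "bdd_above B")
  case bdd: True
  show ?thesis
  proof (cases "Sup B \<in> B")
    case True
    show ?thesis
    proof (rule that[of "\<lambda>_. Sup B"])
      show "B = (\<Union>n::nat. {0<..Sup B})"
        using assms bdd True by (auto intro: cSup_upper)
    qed (use True in \<open>auto simp: incseq_def\<close>)
  next
    case False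
    have less: "c < Sup B" if "c \<in> B" for c
      using that False bdd by (metis cSup_upper less_eq_real_def)
    have mem: "c \<in> B" if "0 < c" "c < Sup B" for c
      using that assms bdd less_cSup_iff[of B c] by (metis less_eq_real_def)
    obtain b0 where "b0 \<in> B" using assms by auto
    then have "0 < Sup B"
      using less[of b0] assms by auto
    \<comment> \<open>The factor 1/2 keeps \<open>b 0\<close> positive.\<close>
    define b where "b n = Sup B - Sup B * (inverse (real (Suc n)) / 2)" for n
    have bpos: "0 < b n" "b n < Sup B" for n
      using \<open>0 < Sup B\<close> by (auto simp: b_def field_simps intro: add_pos_nonneg)
    have "b \<longlonglongrightarrow> Sup B"
    proof -
      have "b \<longlonglongrightarrow> Sup B - Sup B * (0 / 2)"
        unfolding b_def by (intro tendsto_intros LIMSEQ_inverse_real_of_nat) simp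
      then show ?thesis by simp
    qed
    show ?thesis
    proof (rule that)
      show "incseq b"
        unfolding incseq_def b_def using \<open>0 < Sup B\<close>
        by (auto intro!: mult_left_mono le_imp_inverse_le)
      show "range b \<subseteq> B"
        using bpos mem by auto
      show "B = (\<Union>n. {0<..b n})"
      proof (intro equalityI subsetI)
        fix c assume "c \<in> B"
        then have "\<forall>\<^sub>F n in sequentially. c < b n"
          using \<open>b \<longlonglongrightarrow> Sup B\<close> less by (intro order_tendstoD) auto
        then obtain n where "c < b n"
          using eventually_happens'[OF sequentially_bot] by auto
        then show "c \<in> (\<Union>n. {0<..b n})"
          using \<open>c \<in> B\<close> assms by auto (use less_eq_real_def in blast)
      next
        fix c assume "c \<in> (\<Union>n. {0<..b n})"
        then show "c \<in> B"
          using bpos mem by (auto intro: le_less_trans)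
      qed
    qed
  qed
next
  case False
  have mem: "c \<in> B" if "0 < c" for c
    using False that down by (metis bdd_above.I linear)
  show ?thesis
  proof (rule that[of "\<lambda>n. real n + 1"])
    show "B = (\<Union>n. {0<..real n + 1})"
    proof (intro equalityI subsetI)
      fix c assume "c \<in> B"
      obtain n where "c \<le> real n"
        using real_arch_simple by blast
      then show "c \<in> (\<Union>n. {0<..real n + 1})"
        using \<open>c \<in> B\<close> assms(1) by (intro UN_I[of n]) auto
    qed (auto intro: mem)
  qed (auto simp: incseq_def intro!: mem)
qed

lemma emeasure_down_set_eq_SUP:
  fixes b :: "nat \<Rightarrow> real" and s :: ennreal
  assumes "incseq b" "B = (\<Union>n. {0<..b n})"
    and [measurable]: "u \<in> borel_measurable M" "h \<in> borel_measurable M"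
    and pos: "\<And>x. x \<in> space M \<Longrightarrow> 0 < u x"
  shows "emeasure M {x \<in> space M. s < h x \<and> u x \<in> B} = (SUP n. emeasure M {x \<in> space M. s < h x \<and> u x \<le> b n})"
proof (subst SUP_emeasure_incseq)
  show "incseq (\<lambda>n. {x \<in> space M. s < h x \<and> u x \<le> b n})"
    using assms(1) by (auto simp: incseq_def intro: order_trans)
  have "{x \<in> space M. s < h x \<and> u x \<in> B} = (\<Union>n. {x \<in> space M. s < h x \<and> u x \<le> b n})"
    unfolding assms(2) using pos by auto
  then show "emeasure M {x \<in> space M. s < h x \<and> u x \<in> B} = emeasure M (\<Union>n. {x \<in> space M. s < h x \<and> u x \<le> b n})"
    by simp
qed auto

context orlicz
begin

text \<open>For a decreasing \<open>D\<close>, the superlevel set of the integrand is the part of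
  \<open>{s < f}\<close> where the weight lies in a down-set of the half-line. Exhausting the
  down-set by intervals reduces the claim to the hypothesis on joint level sets. In the application
  \<open>D\<close> is one increment of the grid.\<close>

lemma nn_integral_term_increment_le:
  fixes D :: "real \<Rightarrow> ennreal" and s :: ennreal
  assumes sf: "sigma_finite_measure M" "sigma_finite_measure N"
    and [measurable]: "f \<in> borel_measurable M" "v \<in> borel_measurable M"
      "g \<in> borel_measurable N" "w \<in> borel_measurable N"
    and pos: "\<And>x. x \<in> space M \<Longrightarrow> 0 < v x" "\<And>y. y \<in> space N \<Longrightarrow> 0 < w y"
    and le: "\<And>b. 0 < b \<Longrightarrow> emeasure N {y \<in> space N. s < g y \<and> w y \<le> b} \<le> emeasure M {x \<in> space M. s < f x \<and> v x \<le> b}"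
    and D: "\<And>b b'. 0 < b \<Longrightarrow> b \<le> b' \<Longrightarrow> D b' \<le> D b"
    and [measurable]: "(\<lambda>x. D (v x)) \<in> borel_measurable M" "(\<lambda>y. D (w y)) \<in> borel_measurable N"
  shows "(\<integral>\<^sup>+y. D (w y) * indicator {s<..} (g y) \<partial>N) \<le> (\<integral>\<^sup>+x. D (v x) * indicator {s<..} (f x) \<partial>M)"
proof (rule nn_integral_le_of_levels[OF sf])
  fix \<tau> :: real assume "0 \<le> \<tau>"
  define B where "B = {b. 0 < b \<and> ennreal \<tau> < D b}"
  have *: "{x \<in> space M. ennreal \<tau> < D (v x) * indicator {s<..} (f x)} = {x \<in> space M. s < f x \<and> v x \<in> B}"
    "{y \<in> space N. ennreal \<tau> < D (w y) * indicator {s<..} (g y)} = {y \<in> space N. s < g y \<and> w y \<in> B}"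
    using pos by (auto simp: indicator_def B_def)
  show "emeasure N {y \<in> space N. ennreal \<tau> < D (w y) * indicator {s<..} (g y)}
     \<le> emeasure M {x \<in> space M. ennreal \<tau> < D (v x) * indicator {s<..} (f x)}"
  proof (cases "B = {}")
    case True
    then show ?thesis
      unfolding * by simp
  next
    case False
    obtain b where b: "incseq b" "range b \<subseteq> B" "B = (\<Union>n. {0<..b n})"
    proof (rule down_set_exhaustion[OF _ False])
      show "c \<in> B" if "b \<in> B" "0 < c" "c \<le> b" for b c
        using that D[of c b] by (auto simp: B_def)
    qed (auto simp: B_def)
    have bpos: "0 < b n" for n
      using b(2) by (auto simp: B_def)
    show ?thesis
      unfolding *
    proof (subst (1 2) emeasure_down_set_eq_SUP[OF b(1,3)])
      show "(SUP n. emeasure N {y \<in> space N. s < g y \<and> w y \<le> b n})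
          \<le> (SUP n. emeasure M {x \<in> space M. s < f x \<and> v x \<le> b n})"
        using bpos by (intro SUP_mono' le)
    qed (auto simp: pos)
  qed
qed auto

lemma measurable_term_increment:
  assumes [measurable]: "u \<in> borel_measurable M" and pos: "\<And>x. x \<in> space M \<Longrightarrow> 0 < u x" and "0 < \<delta>"
  shows "(\<lambda>x. term_increment \<delta> i (u x)) \<in> borel_measurable M"
proof -
  have "term_increment \<delta> i b = orlicz_term \<phi> (ennreal (real (Suc i) * \<delta>)) b - orlicz_term \<phi> (ennreal (real i * \<delta>)) b"
    if "0 < b" for b
  proof -
    have "0 \<le> \<phi> (real i * \<delta> / b) * b"
      using that \<open>0 < \<delta>\<close> by (intro mult_nonneg_nonneg phi_nonneg) auto
    then show ?thesis
      using \<open>0 < \<delta>\<close> by (simp add: term_increment_def ennreal_minus)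
  qed
  moreover have "(\<lambda>x. orlicz_term \<phi> (ennreal (real (Suc i) * \<delta>)) (u x) - orlicz_term \<phi> (ennreal (real i * \<delta>)) (u x))
      \<in> borel_measurable M"
    using pos by measurable
  ultimately show ?thesis
    using pos by (subst measurable_cong) auto
qed

text \<open>Each summand of the grid is a decreasing function of the weight times the indicator of a
  superlevel set, so the two sides compare term by term. On \<open>M\<close> the grid lies below the
  integrand for every mesh; on \<open>N\<close> Fatou's lemma recovers the integrand as the mesh
  tends to 0.\<close>

lemma nn_integral_term_le:
  assumes sf: "sigma_finite_measure M" "sigma_finite_measure N"
    and [measurable]: "f \<in> borel_measurable M" "v \<in> borel_measurable M"
      "g \<in> borel_measurable N" "w \<in> borel_measurable N"
    and pos [simp]: "\<And>x. x \<in> space M \<Longrightarrow> 0 < v x" "\<And>y. y \<in> space N \<Longrightarrow> 0 < w y"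
    and le: "\<And>s b. 0 \<le> s \<Longrightarrow> 0 < b \<Longrightarrow>
      emeasure N {y \<in> space N. ennreal s < g y \<and> w y \<le> b} \<le> emeasure M {x \<in> space M. ennreal s < f x \<and> v x \<le> b}"
  shows "(\<integral>\<^sup>+y. orlicz_term \<phi> (g y) (w y) \<partial>N) \<le> (\<integral>\<^sup>+x. orlicz_term \<phi> (f x) (v x) \<partial>M)"
proof -
  note [measurable] = measurable_term_increment
  have grid: "(\<integral>\<^sup>+y. term_grid \<delta> (g y) (w y) \<partial>N) \<le> (\<integral>\<^sup>+x. orlicz_term \<phi> (f x) (v x) \<partial>M)"
    if "0 < \<delta>" for \<delta>
  proof -
    have "(\<integral>\<^sup>+y. term_grid \<delta> (g y) (w y) \<partial>N)
      = (\<Sum>i. \<integral>\<^sup>+y. term_increment \<delta> i (w y) * indicator {ennreal (real (Suc i) * \<delta>)<..} (g y) \<partial>N)"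
      unfolding term_grid_def using that by (intro nn_integral_suminf) measurable
    also have "\<dots> \<le> (\<Sum>i. \<integral>\<^sup>+x. term_increment \<delta> i (v x) * indicator {ennreal (real (Suc i) * \<delta>)<..} (f x) \<partial>M)"
      using that by (intro suminf_le nn_integral_term_increment_le[OF sf] term_increment_antimono le pos measurable_term_increment) auto
    also have "\<dots> = (\<integral>\<^sup>+x. term_grid \<delta> (f x) (v x) \<partial>M)"
      unfolding term_grid_def using that by (intro nn_integral_suminf[symmetric]) measurable
    also have "\<dots> \<le> (\<integral>\<^sup>+x. orlicz_term \<phi> (f x) (v x) \<partial>M)"
      using that by (intro nn_integral_mono term_grid_le) auto
    finally show ?thesis .
  qed
  have "(\<integral>\<^sup>+y. orlicz_term \<phi> (g y) (w y) \<partial>N) \<le> (\<integral>\<^sup>+y. liminf (\<lambda>m. term_grid (1 / real (Suc m)) (g y) (w y)) \<partial>N)"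
    by (intro nn_integral_mono term_le_liminf_grid) auto
  also have "\<dots> \<le> liminf (\<lambda>m. \<integral>\<^sup>+y. term_grid (1 / real (Suc m)) (g y) (w y) \<partial>N)"
  proof (rule nn_integral_liminf)
    fix m
    show "(\<lambda>y. term_grid (1 / real (Suc m)) (g y) (w y)) \<in> borel_measurable N"
      unfolding term_grid_def by measurable
  qed
  also have "\<dots> \<le> (\<integral>\<^sup>+x. orlicz_term \<phi> (f x) (v x) \<partial>M)"
    by (intro Liminf_le always_eventually allI grid) auto
  finally show ?thesis .
qed

end

subsection \<open>Decreasing rearrangements and the lower bound\<close>

text \<open>A Galois connection between rearrangement and distribution function; right continuity of
  \<open>G\<close> makes it valid for strict inequalities. The predicate \<open>P\<close> covers
  both conventions, levels \<open>s \<ge> 0\<close> for functions and \<open>s > 0\<close> for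
  sequences.\<close>

lemma less_Inf_level_iff:
  fixes G :: "real \<Rightarrow> ennreal"
  assumes anti: "\<And>s s'. s \<le> s' \<Longrightarrow> G s' \<le> G s"
    and rc: "c < G s \<Longrightarrow> \<exists>s'>s. c < G s'"
    and P: "\<And>s. 0 < s \<Longrightarrow> P s" "\<And>s. P s \<Longrightarrow> 0 \<le> s"
    and "0 \<le> s"
  shows "ennreal s < Inf {ennreal s | s. P s \<and> G s \<le> c} \<longleftrightarrow> c < G s"
proof
  assume "c < G s"
  then obtain s' where s': "s < s'" "c < G s'"
    using rc by auto
  have "ennreal s < ennreal s'"
    using s' \<open>0 \<le> s\<close> by (simp add: ennreal_less_iff)
  also have "ennreal s' \<le> Inf {ennreal s | s. P s \<and> G s \<le> c}"
  proof (rule Inf_greatest)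
    fix y assume "y \<in> {ennreal s | s. P s \<and> G s \<le> c}"
    then obtain u where u: "y = ennreal u" "G u \<le> c"
      by auto
    then have "s' \<le> u"
      using anti[of u s'] s' by (meson leD le_less_trans linear order_trans)
    then show "ennreal s' \<le> y"
      using u by (simp add: ennreal_leI)
  qed
  finally show "ennreal s < Inf {ennreal s | s. P s \<and> G s \<le> c}" .
next
  assume less: "ennreal s < Inf {ennreal s | s. P s \<and> G s \<le> c}"
  show "c < G s"
  proof (rule ccontr)
    assume "\<not> c < G s"
    \<comment> \<open>The level \<open>s\<close> itself may violate \<open>P\<close> when it is 0,
      so the infimum is tested at \<open>s + e\<close>.\<close>
    have "Inf {ennreal s | s. P s \<and> G s \<le> c} \<le> ennreal s"
    proof (rule ennreal_le_epsilon)
      fix e :: real assume "0 < e"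
      have "G (s + e) \<le> c"
        using anti[of s "s + e"] \<open>0 < e\<close> \<open>\<not> c < G s\<close> by (simp add: not_less order_trans)
      then have "Inf {ennreal s | s. P s \<and> G s \<le> c} \<le> ennreal (s + e)"
        using P(1)[of "s + e"] \<open>0 < e\<close> \<open>0 \<le> s\<close> by (intro Inf_lower CollectI exI[of _ "s + e"]) simp
      then show "Inf {ennreal s | s. P s \<and> G s \<le> c} \<le> ennreal s + ennreal e"
        using \<open>0 < e\<close> \<open>0 \<le> s\<close> by simp
    qed
    with less show False by simp
  qed
qed

text \<open>As the level decreases to \<open>s\<close>, the strict superlevel sets increase to that
  of \<open>s\<close>, so continuity from below applies even to infinite measures.\<close>

lemma level_right_continuous:
  fixes f :: "'a \<Rightarrow> real"
  assumes [measurable]: "f \<in> borel_measurable M" and "c < emeasure M {x \<in> space M. s < \<bar>f x\<bar>}"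
  shows "\<exists>s'>s. c < emeasure M {x \<in> space M. s' < \<bar>f x\<bar>}"
proof -
  have "{x \<in> space M. s < \<bar>f x\<bar>} = (\<Union>n. {x \<in> space M. s + inverse (real (Suc n)) < \<bar>f x\<bar>})"
  proof (intro equalityI subsetI)
    fix x assume "x \<in> {x \<in> space M. s < \<bar>f x\<bar>}"
    then show "x \<in> (\<Union>n. {x \<in> space M. s + inverse (real (Suc n)) < \<bar>f x\<bar>})"
      using reals_Archimedean[of "\<bar>f x\<bar> - s"] by (auto simp: less_diff_eq add.commute)
  next
    fix x assume "x \<in> (\<Union>n. {x \<in> space M. s + inverse (real (Suc n)) < \<bar>f x\<bar>})"
    then obtain n where "x \<in> space M" "s + inverse (real (Suc n)) < \<bar>f x\<bar>"
      by auto
    moreover have "0 < inverse (real (Suc n))"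
      by simp
    ultimately have "s < \<bar>f x\<bar>"
      by linarith
    then show "x \<in> {x \<in> space M. s < \<bar>f x\<bar>}"
      using \<open>x \<in> space M\<close> by simp
  qed
  also have "emeasure M \<dots> = (SUP n. emeasure M {x \<in> space M. s + inverse (real (Suc n)) < \<bar>f x\<bar>})"
  proof (rule SUP_emeasure_incseq[symmetric])
    show "incseq (\<lambda>n. {x \<in> space M. s + inverse (real (Suc n)) < \<bar>f x\<bar>})"
    proof (intro incseq_SucI subsetI)
      fix n x
      have "inverse (real (Suc (Suc n))) \<le> inverse (real (Suc n))"
        by (intro le_imp_inverse_le) auto
      moreover assume "x \<in> {x \<in> space M. s + inverse (real (Suc n)) < \<bar>f x\<bar>}"
      then have "x \<in> space M" "s + inverse (real (Suc n)) < \<bar>f x\<bar>"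
        by auto
      ultimately show "x \<in> {x \<in> space M. s + inverse (real (Suc (Suc n))) < \<bar>f x\<bar>}"
        by (metis (mono_tags, lifting) add_left_mono mem_Collect_eq order_le_less_trans)
    qed
  qed auto
  finally obtain n where "c < emeasure M {x \<in> space M. s + inverse (real (Suc n)) < \<bar>f x\<bar>}"
    using assms(2) by (auto simp: less_SUP_iff)
  then show ?thesis
    by (intro exI[of _ "s + inverse (real (Suc n))"]) auto
qed

lemma less_Inf_distribution_iff:
  fixes f :: "'a \<Rightarrow> real"
  assumes [measurable]: "f \<in> borel_measurable M"
    and "\<And>s. 0 < s \<Longrightarrow> P s" "\<And>s. P s \<Longrightarrow> 0 \<le> s" "0 \<le> s"
  shows "ennreal s < Inf {ennreal s | s. P s \<and> emeasure M {x \<in> space M. s < \<bar>f x\<bar>} \<le> c}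
    \<longleftrightarrow> c < emeasure M {x \<in> space M. s < \<bar>f x\<bar>}"
  by (rule less_Inf_level_iff) (auto intro!: emeasure_mono assms level_right_continuous)

text \<open>The measure of \<open>F - V\<close> is at least that of \<open>F\<close> minus that of
  \<open>V\<close>, and nested sets attain this bound. In the application \<open>A\<close> and
  \<open>B\<close> are superlevel sets of \<open>f*\<close> and \<open>w\<close>, and
  \<open>F\<close> and \<open>V\<close> are those of \<open>f\<close> and \<open>v\<close>;
  finiteness of \<open>B\<close> makes the subtraction meaningful.\<close>

lemma emeasure_Diff_nested_le:
  assumes N: "A \<in> sets N" "B \<in> sets N" and M: "F \<in> sets M" "V \<in> sets M"
    and eq: "emeasure N A = emeasure M F" "emeasure N B = emeasure M V"
    and nested: "A \<subseteq> B \<or> (B \<subseteq> A \<and> emeasure N B \<noteq> \<infinity>)"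
  shows "emeasure N (A - B) \<le> emeasure M (F - V)"
proof (cases "A \<subseteq> B")
  case True
  then show ?thesis
    by (simp add: Diff_eq_empty_iff[THEN iffD2])
next
  case False
  then have *: "emeasure N (A - B) = emeasure M F - emeasure M V"
    using nested N eq by (subst emeasure_Diff) auto
  have "emeasure M F \<le> emeasure M (V \<union> (F - V))"
    using M by (intro emeasure_mono) auto
  also have "\<dots> \<le> emeasure M V + emeasure M (F - V)"
    using M by (intro emeasure_subadditive) auto
  finally have "emeasure M F \<le> emeasure M V + emeasure M (F - V)" .
  then show ?thesis
    using * False nested eq by (auto simp: ennreal_minus_le_iff ennreal_minus_mono simp del: Diff_eq_empty_iff)
qed

section \<open>Rearrangement of functions on the half-line\<close>

lemma space_lebesgue_on_I [simp]: "space (lebesgue_on I) = I"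
  by simp

lemma emeasure_lebesgue_on_I: "A \<subseteq> I \<Longrightarrow> emeasure (lebesgue_on I) A = emeasure lebesgue A"
  by (simp add: emeasure_restrict_space)

lemma fun_distr_eq: "fun_distr f s = emeasure (lebesgue_on I) {t \<in> space (lebesgue_on I). s < \<bar>f t\<bar>}"
  unfolding fun_distr_def by (subst emeasure_lebesgue_on_I) auto

lemma less_fun_rearr_iff:
  assumes "f \<in> L0" "0 \<le> s"
  shows "ennreal s < fun_rearr f t \<longleftrightarrow> ennreal t < fun_distr f s"
  unfolding fun_rearr_def fun_distr_eq by (rule less_Inf_distribution_iff) (use assms in auto)

lemma emeasure_initial_interval: "emeasure lebesgue {t \<in> I. ennreal t < g} = g"
proof (cases g)
  case (real r)
  then have "{t \<in> I. ennreal t < g} = {0<..<r}"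
    by (auto simp: ennreal_less_iff)
  then show ?thesis
    using real by simp
next
  case top
  then have *: "{t \<in> I. ennreal t < g} = I"
    by auto
  have "of_nat n \<le> emeasure lebesgue I" for n
  proof -
    have "emeasure lebesgue {0<..<real n} \<le> emeasure lebesgue I"
      by (rule emeasure_mono) auto
    then show ?thesis
      by (simp add: ennreal_of_nat_eq_real_of_nat)
  qed
  then have "emeasure lebesgue I = top"
    by (metis ennreal_SUP_of_nat_eq_top SUP_least top_unique)
  then show ?thesis
    using top * by simp
qed

text \<open>\<open>f*\<close> exceeds \<open>s\<close> exactly on the initial interval of length
  \<open>fun_distr f s\<close>, so \<open>f\<close> and \<open>f*\<close> are
  equimeasurable.\<close>

lemma fun_distr_eq_rearr:
  assumes "f \<in> L0" "0 \<le> s"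
  shows "fun_distr f s = emeasure lebesgue {t \<in> I. ennreal s < fun_rearr f t}"
  unfolding less_fun_rearr_iff[OF assms] emeasure_initial_interval ..

lemma fun_equidistr_iff:
  assumes "f \<in> L0" "g \<in> L0"
  shows "fun_equidistr f g \<longleftrightarrow> (\<forall>s\<ge>0. fun_distr f s = fun_distr g s)"
proof
  assume "fun_equidistr f g"
  then show "\<forall>s\<ge>0. fun_distr f s = fun_distr g s"
    using assms by (auto simp: fun_distr_eq_rearr fun_equidistr_def intro!: arg_cong[of _ _ "emeasure lebesgue"])
next
  assume "\<forall>s\<ge>0. fun_distr f s = fun_distr g s"
  then show "fun_equidistr f g"
    by (simp add: fun_equidistr_def fun_rearr_def cong: conj_cong)
qed

text \<open>Borel rather than Lebesgue measurability is recorded, so that \<open>f*\<close> may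
  later be composed with the rank of a point.\<close>

lemma measurable_fun_rearr [measurable]:
  assumes "f \<in> L0"
  shows "fun_rearr f \<in> borel_measurable borel"
proof (rule borel_measurableI_greater)
  fix y
  show "{t \<in> space borel. y < fun_rearr f t} \<in> sets borel"
  proof (cases y)
    case (real s)
    then show ?thesis
      using assms by (simp add: less_fun_rearr_iff)
  qed simp
qed

lemma L0_of_borel: "f \<in> borel_measurable borel \<Longrightarrow> f \<in> borel_measurable (lebesgue_on I)"
  by (intro measurable_restrict_space1 measurable_completion) simp

lemma L0_antimono_on:
  assumes "antimono_on I (w :: real \<Rightarrow> real)"
  shows "w \<in> L0"
proof -
  have "(\<lambda>t. - w t) \<in> borel_measurable (restrict_space borel I)"
    by (rule borel_measurable_mono_on_fnc) (use assms in \<open>auto simp: monotone_on_def\<close>)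
  then have "(\<lambda>t. - w t) \<in> borel_measurable (lebesgue_on I)"
  proof (rule borel_measurable_subalgebra[rotated 2])
    show "sets (restrict_space borel I) \<subseteq> sets (lebesgue_on I)"
      by (rule mono_restrict_space) auto
  qed (simp add: space_restrict_space)
  then show ?thesis by simp
qed

context orlicz
begin

lemma fun_M_eq: "fun_M \<phi> w f = (\<integral>\<^sup>+t. orlicz_term \<phi> (fun_rearr f t) (w t) \<partial>lebesgue_on I)"
  unfolding fun_M_def by (simp add: nn_integral_restrict_space)

lemma fun_integral_eq: "fun_integral \<phi> v f = (\<integral>\<^sup>+t. orlicz_term \<phi> (ennreal \<bar>f t\<bar>) (v t) \<partial>lebesgue_on I)"
  unfolding fun_integral_def by (simp add: nn_integral_restrict_space)

text \<open>Since \<open>f*\<close> and \<open>w\<close> are both decreasing, their superlevel sets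
  are initial intervals and hence nested, whereas those of \<open>f\<close> and \<open>v\<close>
  have the same measures but arbitrary position. This is the comparison of joint level sets that
  bounds the integrals.\<close>

lemma fun_M_le_fun_integral:
  assumes w: "pos_weight_fun w" and [measurable]: "f \<in> L0" "v \<in> L0"
    and v: "fun_equidistr v w" "\<forall>t\<in>I. 0 < v t"
  shows "fun_M \<phi> w f \<le> fun_integral \<phi> v f"
  unfolding fun_M_eq fun_integral_eq
proof (rule nn_integral_term_le)
  show [measurable]: "w \<in> L0"
    using w by (simp add: pos_weight_fun_def L0_antimono_on)
  show "fun_rearr f \<in> borel_measurable (lebesgue_on I)"
    by (rule L0_of_borel[OF measurable_fun_rearr[OF \<open>f \<in> L0\<close>]])
  have [measurable]: "(\<lambda>t. t) \<in> L0"
    by (rule L0_of_borel) simp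
  fix s b :: real assume "0 \<le> s" "0 < b"
  define A where "A = {t \<in> space (lebesgue_on I). ennreal t < fun_distr f s}"
  define B where "B = {t \<in> space (lebesgue_on I). b < \<bar>w t\<bar>}"
  define F where "F = {t \<in> space (lebesgue_on I). s < \<bar>f t\<bar>}"
  define V where "V = {t \<in> space (lebesgue_on I). b < \<bar>v t\<bar>}"
  have A: "A \<in> sets (lebesgue_on I)"
    unfolding A_def by measurable
  have B: "B \<in> sets (lebesgue_on I)"
    unfolding B_def by measurable
  have F: "F \<in> sets (lebesgue_on I)"
    unfolding F_def by measurable
  have V: "V \<in> sets (lebesgue_on I)"
    unfolding V_def by measurable
  have "emeasure (lebesgue_on I) (A - B) \<le> emeasure (lebesgue_on I) (F - V)"
  proof (rule emeasure_Diff_nested_le)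
    have "emeasure (lebesgue_on I) A = fun_distr f s"
      unfolding A_def by (subst emeasure_lebesgue_on_I) (auto simp: emeasure_initial_interval simp del: greaterThan_iff)
    then show "emeasure (lebesgue_on I) A = emeasure (lebesgue_on I) F"
      unfolding fun_distr_eq F_def .
    show "emeasure (lebesgue_on I) B = emeasure (lebesgue_on I) V"
      unfolding B_def V_def fun_distr_eq[symmetric]
      using v(1) \<open>0 < b\<close> by (simp add: fun_equidistr_iff)
    show "A \<subseteq> B \<or> B \<subseteq> A \<and> emeasure (lebesgue_on I) B \<noteq> \<infinity>"
    proof (cases "A \<subseteq> B")
      case False
      then obtain t where t: "t \<in> A" "t \<notin> B"
        by auto
      \<comment> \<open>Monotonicity of \<open>w\<close> puts all of \<open>B\<close> to the left of
        a point \<open>t\<close> outside it. As \<open>t\<close> lies in the initial interval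
        \<open>A\<close>, so does \<open>B\<close>, and its measure is at most
        \<open>t\<close>.\<close>
      have *: "r < t" if "r \<in> B" for r
      proof (rule ccontr)
        assume "\<not> r < t"
        then have "w r \<le> w t"
          using t(1) w by (auto simp: A_def pos_weight_fun_def monotone_on_def)
        moreover have "0 < w r" "0 < w t"
          using that t w by (auto simp: A_def B_def pos_weight_fun_def)
        moreover have "b < \<bar>w r\<bar>" "\<not> b < \<bar>w t\<bar>"
          using that t by (auto simp: A_def B_def)
        ultimately show False
          by linarith
      qed
      have "B \<subseteq> A"
      proof
        fix r assume "r \<in> B"
        then have "ennreal r \<le> ennreal t"
          using * by (intro ennreal_leI less_imp_le)
        then show "r \<in> A"
          using t(1) \<open>r \<in> B\<close> le_less_trans[of "ennreal r" "ennreal t"] by (simp add: A_def B_def)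
      qed
      moreover have "emeasure (lebesgue_on I) B \<le> emeasure (lebesgue_on I) {0<..<t}"
        using * by (intro emeasure_mono) (auto simp: B_def sets_restrict_space_iff)
      moreover have "emeasure (lebesgue_on I) {0<..<t} = ennreal t"
        using t by (subst emeasure_lebesgue_on_I) (auto simp: A_def)
      ultimately have "B \<subseteq> A" "emeasure (lebesgue_on I) B \<noteq> \<infinity>"
        by (auto simp: top_unique)
      then show ?thesis
        by simp
    qed simp
  qed (fact A B F V)+
  moreover have "A - B = {t \<in> space (lebesgue_on I). ennreal s < fun_rearr f t \<and> w t \<le> b}"
  proof -
    have "b < \<bar>w t\<bar> \<longleftrightarrow> \<not> w t \<le> b" if "t \<in> I" for t
      using w that by (simp add: pos_weight_fun_def abs_of_pos not_le)
    then show ?thesis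
      using \<open>0 \<le> s\<close> less_fun_rearr_iff[OF \<open>f \<in> L0\<close>] by (auto simp: A_def B_def)
  qed
  moreover have "F - V = {t \<in> space (lebesgue_on I). ennreal s < ennreal \<bar>f t\<bar> \<and> v t \<le> b}"
  proof -
    have "b < \<bar>v t\<bar> \<longleftrightarrow> \<not> v t \<le> b" if "t \<in> I" for t
      using v(2) that by (simp add: abs_of_pos not_le)
    then show ?thesis
      using \<open>0 \<le> s\<close> by (auto simp: F_def V_def ennreal_less_iff)
  qed
  ultimately show "emeasure (lebesgue_on I) {t \<in> space (lebesgue_on I). ennreal s < fun_rearr f t \<and> w t \<le> b}
     \<le> emeasure (lebesgue_on I) {t \<in> space (lebesgue_on I). ennreal s < ennreal \<bar>f t\<bar> \<and> v t \<le> b}"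
    by simp
qed (use w v in \<open>auto simp: pos_weight_fun_def sigma_finite_lebesgue_on\<close>)

end

section \<open>Rearrangement of sequences\<close>

lemma seq_distr_eq: "seq_distr x s = emeasure (count_space {1..}) {k \<in> space (count_space {1..}). s < \<bar>x k\<bar>}"
  by (simp add: seq_distr_def)

lemma seq_distr_card:
  "seq_distr x s = (if finite {k \<in> {1..}. s < \<bar>x k\<bar>} then of_nat (card {k \<in> {1..}. s < \<bar>x k\<bar>}) else \<infinity>)"
  unfolding seq_distr_def by (subst emeasure_count_space) auto

lemma less_seq_rearr_iff:
  assumes "0 \<le> s"
  shows "ennreal s < seq_rearr x n \<longleftrightarrow> of_nat (n - 1) < seq_distr x s"
  unfolding seq_rearr_def seq_distr_eq by (rule less_Inf_distribution_iff) (use assms in auto)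

lemma seq_rearr_antimono: "n \<le> n' \<Longrightarrow> seq_rearr x n' \<le> seq_rearr x n"
  unfolding seq_rearr_def
  by (intro Inf_superset_mono Collect_mono ex_mono impI) (auto elim: order_trans)

text \<open>With indices from 1 on, \<open>n - 1 < d\<close> means \<open>n \<le> d\<close>: the
  shift gives the segment exactly \<open>d\<close> elements, and all of \<open>{1..}\<close> when
  \<open>d\<close> is infinite.\<close>

lemma emeasure_initial_segment:
  "emeasure (count_space {1..}) {n \<in> {1..}. of_nat (n - 1) < seq_distr x s} = seq_distr x s"
proof (cases "finite {k \<in> {1..}. s < \<bar>x k\<bar>}")
  case True
  then have "{n \<in> {1..}. (of_nat (n - 1) :: ennreal) < seq_distr x s} = {1..card {k \<in> {1..}. s < \<bar>x k\<bar>}}"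
    by (auto simp: seq_distr_card)
  then show ?thesis
    using True by (simp add: seq_distr_card)
next
  case False
  then have "{n \<in> {1..}. (of_nat (n - 1) :: ennreal) < seq_distr x s} = {1..}"
    by (auto simp: seq_distr_card of_nat_less_top)
  then show ?thesis
    using False by (simp add: seq_distr_card emeasure_count_space infinite_Ici)
qed

lemma seq_distr_eq_rearr:
  assumes "0 \<le> s"
  shows "seq_distr x s = emeasure (count_space {1..}) {n \<in> {1..}. ennreal s < seq_rearr x n}"
  unfolding less_seq_rearr_iff[OF assms] emeasure_initial_segment ..

lemma seq_equidistr_iff: "seq_equidistr x y \<longleftrightarrow> (\<forall>s\<ge>0. seq_distr x s = seq_distr y s)"
proof
  assume "seq_equidistr x y"
  then show "\<forall>s\<ge>0. seq_distr x s = seq_distr y s"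
    by (simp add: seq_distr_eq_rearr seq_equidistr_def cong: conj_cong)
next
  assume "\<forall>s\<ge>0. seq_distr x s = seq_distr y s"
  then show "seq_equidistr x y"
    by (simp add: seq_equidistr_def seq_rearr_def less_imp_le cong: conj_cong)
qed

lemma suminf_Suc_eq_nn_integral:
  fixes g :: "nat \<Rightarrow> ennreal"
  shows "(\<Sum>n. g (Suc n)) = (\<integral>\<^sup>+n. g n \<partial>count_space {1..})"
proof -
  have "bij_betw Suc UNIV {1..}"
    by (auto simp: bij_betw_def image_def) (metis Suc_pred' less_eq_Suc_le)
  then have "(\<integral>\<^sup>+n. g (Suc n) \<partial>count_space UNIV) = (\<integral>\<^sup>+n. g n \<partial>count_space {1..})"
    by (rule nn_integral_bij_count_space)
  then show ?thesis
    by (simp add: nn_integral_count_space_nat)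
qed

context orlicz
begin

lemma seq_m_eq: "seq_m \<phi> w x = (\<integral>\<^sup>+n. orlicz_term \<phi> (seq_rearr x n) (w n) \<partial>count_space {1..})"
  unfolding seq_m_def by (rule suminf_Suc_eq_nn_integral)

lemma seq_sum_eq: "seq_sum \<phi> v x = (\<integral>\<^sup>+n. orlicz_term \<phi> (ennreal \<bar>x n\<bar>) (v n) \<partial>count_space {1..})"
  unfolding seq_sum_def by (subst suminf_Suc_eq_nn_integral[symmetric]) simp

text \<open>The argument for functions with counting measure: superlevel sets of \<open>x*\<close>
  and \<open>w\<close> are initial segments, hence nested, and an index outside such a segment makes
  it finite.\<close>

lemma seq_m_le_seq_sum:
  assumes w: "pos_weight_seq w" and v: "seq_equidistr v w" "\<forall>n\<ge>1. 0 < v n"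
  shows "seq_m \<phi> w x \<le> seq_sum \<phi> v x"
  unfolding seq_m_eq seq_sum_eq
proof (rule nn_integral_term_le)
  fix s b :: real assume "0 \<le> s" "0 < b"
  define A where "A = {n \<in> {1..}. of_nat (n - 1) < seq_distr x s}"
  define B where "B = {n \<in> {1..}. b < \<bar>w n\<bar>}"
  define F where "F = {n \<in> {1..}. s < \<bar>x n\<bar>}"
  define V where "V = {n \<in> {1..}. b < \<bar>v n\<bar>}"
  have "emeasure (count_space {1..}) (A - B) \<le> emeasure (count_space {1..}) (F - V)"
  proof (rule emeasure_Diff_nested_le)
    show "emeasure (count_space {1..}) A = emeasure (count_space {1..}) F"
      unfolding A_def F_def emeasure_initial_segment by (simp add: seq_distr_def)
    show "emeasure (count_space {1..}) B = emeasure (count_space {1..}) V"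
      unfolding B_def V_def seq_distr_def[symmetric]
      using v(1) \<open>0 < b\<close> by (simp add: seq_equidistr_iff)
    show "A \<subseteq> B \<or> B \<subseteq> A \<and> emeasure (count_space {1..}) B \<noteq> \<infinity>"
    proof (cases "A \<subseteq> B")
      case False
      then obtain t where t: "t \<in> A" "t \<notin> B"
        by auto
      have *: "r < t" if "r \<in> B" for r
      proof (rule ccontr)
        assume "\<not> r < t"
        then have "w r \<le> w t"
          using t(1) w by (auto simp: A_def pos_weight_seq_def monotone_on_def)
        moreover have "0 < w r" "0 < w t"
          using that t w by (auto simp: A_def B_def pos_weight_seq_def)
        moreover have "b < \<bar>w r\<bar>" "\<not> b < \<bar>w t\<bar>"
          using that t by (auto simp: A_def B_def)
        ultimately show False
          by linarith
      qed
      have "B \<subseteq> A"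
      proof
        fix r assume "r \<in> B"
        then have "(of_nat (r - 1) :: ennreal) \<le> of_nat (t - 1)"
          using * by (simp add: diff_le_mono less_imp_le)
        then show "r \<in> A"
          using t(1) \<open>r \<in> B\<close> le_less_trans[of "of_nat (r - 1)" "of_nat (t - 1)" "seq_distr x s"]
          by (simp add: A_def B_def)
      qed
      moreover have "finite B"
        using * by (intro finite_subset[of B "{..<t}"]) auto
      then have "emeasure (count_space {1..}) B \<noteq> \<infinity>"
        by (subst emeasure_count_space) (auto simp: B_def)
      ultimately show ?thesis
        by simp
    qed simp
  qed (auto simp: A_def B_def F_def V_def)
  moreover have "A - B = {n \<in> space (count_space {1..}). ennreal s < seq_rearr x n \<and> w n \<le> b}"
    using w \<open>0 \<le> s\<close> by (auto simp: A_def B_def pos_weight_seq_def less_seq_rearr_iff)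
  moreover have "F - V = {n \<in> space (count_space {1..}). ennreal s < ennreal \<bar>x n\<bar> \<and> v n \<le> b}"
    using v(2) \<open>0 \<le> s\<close> by (auto simp: F_def V_def ennreal_less_iff)
  ultimately show "emeasure (count_space {1..}) {n \<in> space (count_space {1..}). ennreal s < seq_rearr x n \<and> w n \<le> b}
     \<le> emeasure (count_space {1..}) {n \<in> space (count_space {1..}). ennreal s < ennreal \<bar>x n\<bar> \<and> v n \<le> b}"
    by simp
qed (use w v in \<open>auto simp: pos_weight_seq_def sigma_finite_measure_count_space_countable\<close>)

end

subsection \<open>Greedy automorphisms\<close>

text \<open>If some value outside \<open>U\<close> is positive, only finitely many are as large, so
  a maximum exists; otherwise all values outside \<open>U\<close> are 0 and any index will
  do.\<close>

lemma exists_maximal_outside: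
  fixes X :: "nat \<Rightarrow> real"
  assumes "finite U" and nonneg: "\<And>k. 0 \<le> X k" and fin: "\<And>s. 0 < s \<Longrightarrow> finite {k. s < X k}"
  shows "\<exists>k. k \<notin> U \<and> (\<forall>j. j \<notin> U \<longrightarrow> X j \<le> X k)"
proof (cases "\<exists>k. k \<notin> U \<and> 0 < X k")
  case True
  then obtain k0 where k0: "k0 \<notin> U" "0 < X k0" by auto
  define S where "S = {k. k \<notin> U \<and> X k0 \<le> X k}"
  have "finite S"
    by (rule finite_subset[OF _ fin[of "X k0 / 2"]]) (use k0 in \<open>auto simp: S_def\<close>)
  moreover have "S \<noteq> {}"
    using k0 by (auto simp: S_def)
  ultimately have "Max (X ` S) \<in> X ` S"
    by (intro Max_in) auto
  then obtain k where k: "k \<in> S" "X k = Max (X ` S)"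
    by auto
  have "X j \<le> X k" if "j \<notin> U" for j
  proof (cases "j \<in> S")
    case True
    then show ?thesis
      using k \<open>finite S\<close> by simp
  next
    case False
    then show ?thesis
      using k(1) that by (auto simp: S_def)
  qed
  then show ?thesis
    using k(1) by (auto simp: S_def)
next
  case False
  obtain k where "k \<notin> U"
    using \<open>finite U\<close> infinite_UNIV_nat by (metis ex_new_if_finite)
  then show ?thesis
    using False nonneg by (metis not_less order_trans)
qed

text \<open>The steps without \<open>c\<close> pick the least unused index, which makes the enumeration surjective.\<close>

lemma greedy_enumeration:
  fixes X :: "nat \<Rightarrow> real" and c :: "nat \<Rightarrow> bool"
  assumes nonneg: "\<And>k. 0 \<le> X k" and fin: "\<And>s. 0 < s \<Longrightarrow> finite {k. s < X k}"
    and inf: "infinite {n. \<not> c n}"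
  obtains g :: "nat \<Rightarrow> nat" where "bij g" "\<And>i n. i \<le> n \<Longrightarrow> c i \<Longrightarrow> X (g n) \<le> X (g i)"
proof -
  define pick where "pick n U =
    (if c n then SOME k. k \<notin> U \<and> (\<forall>j. j \<notin> U \<longrightarrow> X j \<le> X k) else LEAST k. k \<notin> U)" for n and U :: "nat set"
  define U where "U = rec_nat {} (\<lambda>n U. insert (pick n U) U)"
  define g where "g n = pick n (U n)" for n
  have U_Suc: "U (Suc n) = insert (g n) (U n)" for n
    by (simp add: U_def g_def)
  have U: "U n = g ` {..<n}" for n
    by (induction n) (simp add: U_def, simp add: U_Suc lessThan_Suc)
  then have fU: "finite (U n)" for n
    by simp
  then obtain fresh: "\<exists>k. k \<notin> U n" for n
    by (metis ex_new_if_finite infinite_UNIV_nat)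
  have max: "g n \<notin> U n \<and> (\<forall>j. j \<notin> U n \<longrightarrow> X j \<le> X (g n))" if "c n" for n
    using someI_ex[OF exists_maximal_outside[OF fU nonneg fin]] that by (simp add: g_def pick_def)
  have least: "g n \<notin> U n \<and> (\<forall>j. j \<notin> U n \<longrightarrow> g n \<le> j)" if "\<not> c n" for n
    using LeastI_ex[OF fresh[of n]] that by (auto simp: g_def pick_def intro: Least_le)
  have notin: "g n \<notin> U n" for n
    using max least by blast
  have "inj g"
  proof (rule injI)
    have "g i \<noteq> g n" if "i < n" for i n
      using notin[of n] that unfolding U by (metis image_eqI lessThan_iff)
    then show "i = n" if "g i = g n" for i n
      using that by (metis linorder_neqE_nat)
  qed
  moreover have "surj g"
  proof (rule ccontr)
    assume "\<not> surj g"
    then obtain k where k: "k \<notin> range g" by auto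
    then have "g n \<le> k" if "\<not> c n" for n
    proof -
      have "k \<notin> U n"
        using k unfolding U by blast
      then show ?thesis
        using least[OF that] by simp
    qed
    then have "g ` {n. \<not> c n} \<subseteq> {..k}"
      by auto
    then show False
      using inf \<open>inj g\<close> by (meson finite_atMost finite_imageD finite_subset inj_on_subset subset_UNIV)
  qed
  moreover have "X (g n) \<le> X (g i)" if "i \<le> n" "c i" for i n
  proof -
    have "g n \<notin> U i"
      using that(1) unfolding U by (auto dest: injD[OF \<open>inj g\<close>])
    then show ?thesis
      using max[OF that(2)] by auto
  qed
  ultimately show ?thesis
    by (intro that[of g]) (auto simp: bij_def)
qed

text \<open>The value chosen at step \<open>n\<close> is dominated by itself and by the choices of
  all earlier steps with \<open>c\<close>. Were it above the rearrangement at this rank, too many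
  terms would exceed the level. Steps without \<open>c\<close> add nothing to the count.\<close>

lemma greedy_le_rearr:
  fixes g :: "nat \<Rightarrow> nat"
  assumes "inj g" and max: "\<And>i. i \<le> n \<Longrightarrow> c i \<Longrightarrow> \<bar>x (Suc (g n))\<bar> \<le> \<bar>x (Suc (g i))\<bar>"
  shows "ennreal \<bar>x (Suc (g n))\<bar> \<le> seq_rearr x (Suc (card {i. i < n \<and> c i}))"
proof (rule ccontr)
  assume "\<not> ?thesis"
  then have less: "seq_rearr x (Suc (card {i. i < n \<and> c i})) < ennreal \<bar>x (Suc (g n))\<bar>"
    by simp
  then obtain s where s: "seq_rearr x (Suc (card {i. i < n \<and> c i})) = ennreal s" "0 \<le> s"
    by (cases "seq_rearr x (Suc (card {i. i < n \<and> c i}))") auto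
  define J where "J = insert n {i. i < n \<and> c i}"
  have fin: "finite {i. i < n \<and> c i}"
    by (rule finite_subset[of _ "{..<n}"]) auto
  then have J: "finite J" "card J = Suc (card {i. i < n \<and> c i})"
    by (auto simp: J_def)
  have sub: "(Suc \<circ> g) ` J \<subseteq> {k \<in> {1..}. s < \<bar>x k\<bar>}"
  proof (intro image_subsetI)
    fix i assume "i \<in> J"
    then have "\<bar>x (Suc (g n))\<bar> \<le> \<bar>x (Suc (g i))\<bar>"
      using max[of i] by (auto simp: J_def)
    moreover have "s < \<bar>x (Suc (g n))\<bar>"
      using less s by (simp add: ennreal_less_iff)
    ultimately show "(Suc \<circ> g) i \<in> {k \<in> {1..}. s < \<bar>x k\<bar>}"
      by simp
  qed
  have "of_nat (card {i. i < n \<and> c i}) < (of_nat (card J) :: ennreal)"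
    unfolding J by simp
  also have "of_nat (card J) \<le> seq_distr x s"
  proof -
    have "card ((Suc \<circ> g) ` J) = card J"
      by (rule card_image, rule inj_on_subset[OF inj_compose[OF inj_Suc \<open>inj g\<close>]]) simp
    then have "(of_nat (card J) :: ennreal) = emeasure (count_space {1..}) ((Suc \<circ> g) ` J)"
      using J by (subst emeasure_count_space) auto
    also have "\<dots> \<le> seq_distr x s"
      unfolding seq_distr_def using sub by (intro emeasure_mono) auto
    finally show ?thesis .
  qed
  finally show False
    using less_seq_rearr_iff[OF s(2), of x "Suc (card {i. i < n \<and> c i})"] s by simp
qed

text \<open>The schedule is greedy during the first \<open>N\<close> steps and at every second step
  from then on, starting with step \<open>N\<close>; so half of the \<open>n - N\<close> later
  steps, rounded up, are greedy.\<close>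

lemma card_greedy_steps:
  "card {i. i < n \<and> (i < N \<or> even (i - N))} = (if n \<le> N then n else N + (n - N + 1) div 2)"
proof (induction n)
  case (Suc n)
  have *: "{i. i < Suc n \<and> P i} = (if P n then insert n {i. i < n \<and> P i} else {i. i < n \<and> P i})" for P
    by (auto simp: less_Suc_eq)
  have fin: "finite {i. i < n \<and> P i}" for P
    by (rule finite_subset[of _ "{..<n}"]) auto
  have card: "card {i. i < Suc n \<and> P i} = card {i. i < n \<and> P i} + (if P n then 1 else 0)" for P
    unfolding * using fin by simp
  show ?case
  proof (cases "n < N")
    case True
    then show ?thesis
      unfolding card Suc by simp
  next
    case False
    then obtain j where "n = N + j"
      by (auto simp: not_less le_iff_add)
    then show ?thesis
      unfolding card Suc by (cases "even j") (auto elim!: evenE oddE)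
  qed
qed simp

lemma sum_lessThan_add:
  fixes a :: "nat \<Rightarrow> 'a::comm_monoid_add"
  shows "sum a {..<N + m} = sum a {..<N} + (\<Sum>i<m. a (N + i))"
  by (induction m) (auto simp: add.assoc)

lemma ennreal_suminf_tail:
  fixes q :: "nat \<Rightarrow> ennreal"
  assumes "(\<Sum>k. q k) < \<infinity>" "0 < e"
  obtains N where "\<And>m. (\<Sum>i<m. q (N + i)) < e"
proof -
  have "(\<Sum>k. q k) < (\<Sum>k. q k) + e"
    using assms by (metis ennreal_add_left_cancel_less add.right_neutral infinity_ennreal_def less_irrefl)
  then have "(SUP N. \<Sum>k<N. q k) < (SUP N. (\<Sum>k<N. q k) + e)"
    unfolding suminf_eq_SUP[of q] by (subst ennreal_SUP_add_left) (auto simp: suminf_eq_SUP)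
  then obtain N where N: "(\<Sum>k. q k) < (\<Sum>k<N. q k) + e"
    by (auto simp: less_SUP_iff suminf_eq_SUP)
  show ?thesis
  proof (rule that)
    fix m
    have "(\<Sum>k<N. q k) + (\<Sum>i<m. q (N + i)) = (\<Sum>k<N + m. q k)"
      by (rule sum_lessThan_add[symmetric])
    also have "\<dots> \<le> (\<Sum>k. q k)"
      by (rule sum_le_suminf) auto
    also note N
    finally show "(\<Sum>i<m. q (N + i)) < e"
      by (simp add: ennreal_add_left_cancel_less)
  qed
qed

context orlicz
begin

text \<open>If infinitely many terms exceed \<open>s\<close>, so does every value of
  \<open>x*\<close>, and each summand is at least the positive constant taken at \<open>s\<close>
  and \<open>w 2\<close>.\<close>

lemma seq_distr_finite:
  assumes w: "pos_weight_seq w"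
    and Q: "(\<Sum>k. orlicz_term \<phi> (seq_rearr x (Suc k)) (w (2 * Suc k))) < \<infinity>" and "0 < s"
  shows "seq_distr x s < \<infinity>"
proof (rule ccontr)
  assume "\<not> seq_distr x s < \<infinity>"
  then have top: "seq_distr x s = top"
    by (simp add: less_top[symmetric])
  define c where "c = orlicz_term \<phi> (ennreal s) (w 2)"
  have "0 < c"
    unfolding c_def using w \<open>0 < s\<close> by (intro term_pos) (auto simp: pos_weight_seq_def)
  have "c \<le> orlicz_term \<phi> (seq_rearr x (Suc k)) (w (2 * Suc k))" for k
  proof -
    have "ennreal s < seq_rearr x (Suc k)"
      using \<open>0 < s\<close> top by (simp add: less_seq_rearr_iff of_nat_less_top)
    moreover have "0 < w (2 * Suc k)" "w (2 * Suc k) \<le> w 2"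
      using w by (auto simp: pos_weight_seq_def monotone_on_def)
    ultimately show ?thesis
      unfolding c_def by (meson less_imp_le order_trans term_mono term_antimono)
  qed
  then have "(\<Sum>k. c) \<le> (\<Sum>k. orlicz_term \<phi> (seq_rearr x (Suc k)) (w (2 * Suc k)))"
    by (intro suminf_le) auto
  moreover have "(\<Sum>k::nat. c) = top"
    using \<open>0 < c\<close> by (simp add: nn_integral_count_space_nat[symmetric] ennreal_mult_eq_top_iff)
  ultimately show False
    using Q by (simp add: top_unique)
qed

text \<open>The terms receive the weights in the order in which the greedy enumeration lists them.
  The first \<open>N\<close> cost at most what they cost in \<open>seq_m\<close>; the later ones are
  grouped in pairs, each costing at most twice one term of the tail of the finite series, whence
  \<open>2 * e\<close>.\<close>

lemma seq_sum_near_optimal: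
  assumes w: "pos_weight_seq w"
    and Q: "(\<Sum>k. orlicz_term \<phi> (seq_rearr x (Suc k)) (w (2 * Suc k))) < \<infinity>" and "0 < e"
  shows "\<exists>\<sigma>. bij_betw \<sigma> {1..} {1..} \<and> seq_sum \<phi> (w \<circ> \<sigma>) x \<le> seq_m \<phi> w x + 2 * e"
proof -
  define q where "q k = orlicz_term \<phi> (seq_rearr x (Suc k)) (w (2 * Suc k))" for k
  obtain N where N: "\<And>m. (\<Sum>i<m. q (N + i)) < e"
    using ennreal_suminf_tail[of q e] Q \<open>0 < e\<close> unfolding q_def by blast
  define c where "c n \<longleftrightarrow> n < N \<or> even (n - N)" for n
  have wpos: "0 < w n" if "1 \<le> n" for n
    using w that by (simp add: pos_weight_seq_def)
  have wanti: "w m \<le> w n" if "1 \<le> n" "n \<le> m" for m n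
    using w that by (simp add: pos_weight_seq_def monotone_on_def)
  obtain g where "bij g" and max: "\<And>i n. i \<le> n \<Longrightarrow> c i \<Longrightarrow> \<bar>x (Suc (g n))\<bar> \<le> \<bar>x (Suc (g i))\<bar>"
  proof (rule greedy_enumeration[of "\<lambda>k. \<bar>x (Suc k)\<bar>" c])
    show "finite {k. s < \<bar>x (Suc k)\<bar>}" if "0 < s" for s
    proof -
      have "finite {k \<in> {1..}. s < \<bar>x k\<bar>}"
        using seq_distr_finite[OF w Q that] by (auto simp: seq_distr_card split: if_splits)
      then have "finite (Suc -` {k \<in> {1..}. s < \<bar>x k\<bar>})"
        by (rule finite_vimageI) simp
      then show ?thesis
        by (simp add: vimage_def)
    qed
    have "(\<lambda>i. N + Suc (2 * i)) ` UNIV \<subseteq> {n. \<not> c n}"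
      by (auto simp: c_def)
    moreover have "infinite ((\<lambda>i. N + Suc (2 * i)) ` UNIV)"
      by (intro range_inj_infinite) (auto simp: inj_def)
    ultimately show "infinite {n. \<not> c n}"
      using finite_subset by blast
  qed auto
  \<comment> \<open>The enumeration \<open>g\<close> counts from 0 and sequences from 1: \<sigma>
    takes the index \<open>Suc (g n)\<close> to its place \<open>Suc n\<close> in the
    enumeration.\<close>
  define \<sigma> where "\<sigma> n = Suc (inv g (n - 1))" for n
  have \<sigma>: "\<sigma> (Suc (g n)) = Suc n" for n
    using \<open>bij g\<close> by (simp add: \<sigma>_def bij_is_inj)
  have "bij_betw \<sigma> {1..} {1..}"
  proof (rule bij_betw_byWitness[where f' = "\<lambda>n. Suc (g (n - 1))"])
    show "\<forall>a\<in>{1..}. Suc (g (\<sigma> a - 1)) = a"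
      using \<open>bij g\<close> by (auto simp: \<sigma>_def surj_f_inv_f bij_is_surj)
    show "\<forall>a\<in>{1..}. \<sigma> (Suc (g (a - 1))) = a"
      by (auto simp: \<sigma>)
  qed (auto simp: \<sigma>_def)
  moreover have "seq_sum \<phi> (w \<circ> \<sigma>) x \<le> seq_m \<phi> w x + 2 * e"
  proof -
    define a where "a n = orlicz_term \<phi> (ennreal \<bar>x (Suc (g n))\<bar>) (w (Suc n))" for n
    have rearr: "ennreal \<bar>x (Suc (g n))\<bar> \<le> seq_rearr x (Suc (if n \<le> N then n else N + (n - N + 1) div 2))" for n
      using greedy_le_rearr[of g n c x] max \<open>bij g\<close> unfolding c_def card_greedy_steps by (simp add: bij_is_inj)
    have head: "a n \<le> orlicz_term \<phi> (seq_rearr x (Suc n)) (w (Suc n))" if "n < N" for n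
      unfolding a_def using rearr[of n] that wpos by (intro term_mono) auto
    \<comment> \<open>The place \<open>Suc (N + j)\<close> is at most twice the rank
      \<open>Suc (N + j div 2)\<close>, so its weight is at least the one used in
      \<open>q\<close>.\<close>
    have tail: "a (N + j) \<le> q (N + j div 2)" for j
    proof -
      have "ennreal \<bar>x (Suc (g (N + j)))\<bar> \<le> seq_rearr x (Suc (N + (j + 1) div 2))"
        using rearr[of "N + j"] by (cases "j = 0") auto
      also have "\<dots> \<le> seq_rearr x (Suc (N + j div 2))"
        by (rule seq_rearr_antimono) (simp add: div_le_mono)
      finally have "a (N + j) \<le> orlicz_term \<phi> (seq_rearr x (Suc (N + j div 2))) (w (Suc (N + j)))"
        unfolding a_def using wpos by (intro term_mono) auto
      also have "\<dots> \<le> q (N + j div 2)"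
        unfolding q_def by (intro term_antimono wpos wanti) auto
      finally show ?thesis .
    qed
    have two: "(\<Sum>j<2 * m. a (N + j)) \<le> 2 * (\<Sum>i<m. q (N + i))" for m
    proof (induction m)
      case (Suc m)
      have "(\<Sum>j<2 * Suc m. a (N + j)) = (\<Sum>j<2 * m. a (N + j)) + (a (N + 2 * m) + a (N + Suc (2 * m)))"
        by (simp add: add.assoc)
      also have "\<dots> \<le> 2 * (\<Sum>i<m. q (N + i)) + (q (N + m) + q (N + m))"
        using tail[of "2 * m"] tail[of "Suc (2 * m)"] by (intro add_mono Suc) auto
      also have "\<dots> = 2 * (\<Sum>i<Suc m. q (N + i))"
        by (simp add: distrib_left mult_2)
      finally show ?case .
    qed simp
    have "seq_sum \<phi> (w \<circ> \<sigma>) x = (\<Sum>n. a n)"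
    proof -
      have "(\<integral>\<^sup>+n. orlicz_term \<phi> (ennreal \<bar>x (Suc (g n))\<bar>) ((w \<circ> \<sigma>) (Suc (g n))) \<partial>count_space UNIV)
          = (\<integral>\<^sup>+k. orlicz_term \<phi> (ennreal \<bar>x (Suc k)\<bar>) ((w \<circ> \<sigma>) (Suc k)) \<partial>count_space UNIV)"
        by (rule nn_integral_bij_count_space) fact
      then show ?thesis
        by (simp add: seq_sum_def a_def \<sigma> nn_integral_count_space_nat)
    qed
    also have "\<dots> \<le> seq_m \<phi> w x + 2 * e"
      unfolding suminf_eq_SUP[of a]
    proof (rule SUP_least)
      fix m
      have "(\<Sum>n<m. a n) \<le> (\<Sum>n<N + 2 * m. a n)"
        by (intro sum_mono2) auto
      also have "\<dots> = (\<Sum>n<N. a n) + (\<Sum>j<2 * m. a (N + j))"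
        by (rule sum_lessThan_add)
      also have "\<dots> \<le> (\<Sum>n<N. orlicz_term \<phi> (seq_rearr x (Suc n)) (w (Suc n))) + 2 * (\<Sum>i<m. q (N + i))"
        by (intro add_mono sum_mono head two) auto
      also have "\<dots> \<le> seq_m \<phi> w x + 2 * e"
        unfolding seq_m_def using N[of m] by (intro add_mono sum_le_suminf mult_left_mono) auto
      finally show "(\<Sum>n<m. a n) \<le> seq_m \<phi> w x + 2 * e" .
    qed
    finally show ?thesis .
  qed
  ultimately show ?thesis by blast
qed

end

subsection \<open>Measure preserving maps from ranks\<close>

text \<open>The probability integral transform for a measure of arbitrary total mass: if the
  distribution function \<open>F\<close> of \<open>g\<close> is continuous, then
  \<open>F (g x)\<close> is uniformly distributed. The minimum covers the case that the mass is
  exhausted below \<open>c\<close>.\<close>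

lemma emeasure_cdf_transform:
  fixes g :: "'a \<Rightarrow> real" and F :: "real \<Rightarrow> real"
  assumes [measurable]: "g \<in> borel_measurable M" and nonneg: "\<And>x. x \<in> space M \<Longrightarrow> 0 \<le> g x"
    and F: "\<And>s. emeasure M {x \<in> space M. g x \<le> s} = ennreal (F s)" "\<And>s. 0 \<le> F s"
    and cont: "continuous_on UNIV F" and "0 \<le> c"
  shows "emeasure M {x \<in> space M. F (g x) \<le> c} = min (ennreal c) (emeasure M (space M))"
proof -
  have mono: "F s \<le> F t" if "s \<le> t" for s t
  proof -
    have "ennreal (F s) \<le> ennreal (F t)"
      unfolding F(1)[symmetric] using that by (intro emeasure_mono) auto
    then show ?thesis
      using F(2) by simp
  qed
  show ?thesis
  proof (cases "\<forall>s. F s \<le> c")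
    case True
    have "space M = (\<Union>n::nat. {x \<in> space M. g x \<le> real n})"
      using real_arch_simple by auto
    then have "emeasure M (space M) = (SUP n::nat. emeasure M {x \<in> space M. g x \<le> real n})"
      by (subst SUP_emeasure_incseq) (auto simp: incseq_def)
    also have "\<dots> \<le> ennreal c"
      using True by (intro SUP_least) (auto simp: F(1) intro: ennreal_leI)
    finally show ?thesis
      using True by (simp add: min_def)
  next
    case False
    then obtain s1 where s1: "c < F s1"
      by (auto simp: not_le)
    define D where "D = {s. F s \<le> c}"
    \<comment> \<open>No value of \<open>g\<close> is at or below -1; this makes \<open>D\<close>
      nonempty even for \<open>c = 0\<close>.\<close>
    have "F (- 1) = 0"
    proof -
      have "{x \<in> space M. g x \<le> - 1} = {}"
        using nonneg by fastforce
      then have "ennreal (F (- 1)) = 0"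
        unfolding F(1)[symmetric] by (simp only: emeasure_empty)
      then show ?thesis
        using F(2)[of "- 1"] by (simp add: ennreal_eq_0_iff)
    qed
    then have "- 1 \<in> D"
      using \<open>0 \<le> c\<close> by (simp add: D_def)
    then have "D \<noteq> {}"
      by blast
    have D_less: "s < s1" if "s \<in> D" for s
      using that s1 mono[of s1 s] by (auto simp: D_def not_le[symmetric])
    then have bdd: "bdd_above D"
      by (intro bdd_aboveI[of _ s1]) (auto intro: less_imp_le)
    have "closed D"
      unfolding D_def by (intro closed_Collect_le cont continuous_on_const)
    then have s0: "Sup D \<in> D"
      using closed_contains_Sup[of D] bdd \<open>D \<noteq> {}\<close> by simp
    \<comment> \<open>By continuity the last point of \<open>D\<close> carries the value
      \<open>c\<close> exactly, so the sublevel set of \<open>F \<circ> g\<close> is the sublevel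
      set of \<open>g\<close> at that point.\<close>
    have "\<exists>s\<ge>Sup D. s \<le> s1 \<and> F s = c"
      using s0 s1 D_less[OF s0] cont by (intro IVT') (auto simp: D_def intro: continuous_on_subset)
    then have "F (Sup D) = c"
      using bdd by (metis (mono_tags, lifting) D_def antisym cSup_upper mem_Collect_eq order_refl)
    have "{x \<in> space M. F (g x) \<le> c} = {x \<in> space M. g x \<le> Sup D}"
      using mono s0 bdd by (auto simp: D_def intro: cSup_upper order_trans)
    then have "emeasure M {x \<in> space M. F (g x) \<le> c} = ennreal c"
      using F(1)[of "Sup D"] \<open>F (Sup D) = c\<close> by simp
    moreover have "ennreal c \<le> emeasure M (space M)"
    proof -
      have "ennreal c \<le> emeasure M {x \<in> space M. g x \<le> s1}"
        using s1 by (simp add: F(1) ennreal_leI)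
      also have "\<dots> \<le> emeasure M (space M)"
        by (rule emeasure_space)
      finally show ?thesis .
    qed
    ultimately show ?thesis
      by (simp add: min_def)
  qed
qed

lemma continuous_on_of_real_lipschitz:
  fixes F :: "real \<Rightarrow> real"
  assumes "\<And>s t. s \<le> t \<Longrightarrow> F s \<le> F t" "\<And>s t. s \<le> t \<Longrightarrow> F t \<le> F s + L * (t - s)" "0 \<le> L"
  shows "continuous_on UNIV F"
proof (rule lipschitz_on_continuous_on)
  show "L-lipschitz_on UNIV F"
  proof (rule lipschitz_onI)
    fix s t :: real
    have *: "dist (F s) (F t) \<le> L * dist s t" if "s \<le> t" for s t
      using assms(1,2)[OF that] that by (simp add: dist_real_def)
    show "dist (F s) (F t) \<le> L * dist s t"
      using *[of s t] *[of t s] by (cases "s \<le> t") (auto simp: dist_commute)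
  qed fact
qed

lemma Int_atMost_lmeasurable:
  assumes "E \<in> sets lebesgue" "E \<subseteq> I"
  shows "E \<inter> {..t::real} \<in> lmeasurable"
proof (rule fmeasurableI2)
  show "{0..t} \<in> lmeasurable" by simp
qed (use assms in auto)

text \<open>The measure of \<open>E\<close> up to \<open>t\<close> is the distribution function of
  the identity on \<open>E\<close>. It is 1-Lipschitz, so the transform of the identity by it is
  uniform.\<close>

lemma emeasure_position_le:
  assumes E: "E \<in> sets lebesgue" "E \<subseteq> I" and "0 \<le> c"
  shows "{t \<in> E. measure lebesgue (E \<inter> {..t}) \<le> c} \<in> sets lebesgue"
    and "emeasure lebesgue {t \<in> E. measure lebesgue (E \<inter> {..t}) \<le> c} = min (ennreal c) (emeasure lebesgue E)"
proof -
  define F where "F t = measure lebesgue (E \<inter> {..t})" for t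
  note lm = Int_atMost_lmeasurable[OF E]
  have cont: "continuous_on UNIV F"
  proof (rule continuous_on_of_real_lipschitz)
    fix s t :: real assume "s \<le> t"
    show "F s \<le> F t"
      unfolding F_def using \<open>s \<le> t\<close> lm by (intro measure_mono_fmeasurable) (auto simp: fmeasurableD)
    have "F t \<le> measure lebesgue (E \<inter> {..s} \<union> {s..t})"
      unfolding F_def using lm[of s] lm[of t] by (intro measure_mono_fmeasurable) (auto simp: fmeasurableD)
    also have "\<dots> \<le> F s + measure lebesgue {s..t}"
      unfolding F_def using lm[of s] by (intro measure_Un_le) (auto simp: fmeasurableD)
    finally show "F t \<le> F s + 1 * (t - s)"
      using \<open>s \<le> t\<close> by simp
  qed simp
  have "mono F"
    unfolding mono_def F_def using lm by (auto intro!: measure_mono_fmeasurable simp: fmeasurableD)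
  then have [measurable]: "F \<in> borel_measurable borel"
    by (rule borel_measurable_mono)
  have "{t. F t \<le> c} \<in> sets borel"
    by measurable
  then show "{t \<in> E. measure lebesgue (E \<inter> {..t}) \<le> c} \<in> sets lebesgue"
    using E sets.Int[of E lebesgue "{t. F t \<le> c}"] by (simp add: F_def Int_def)
  have "emeasure (lebesgue_on E) {t \<in> space (lebesgue_on E). F t \<le> c}
      = min (ennreal c) (emeasure (lebesgue_on E) (space (lebesgue_on E)))"
  proof (rule emeasure_cdf_transform[OF _ _ _ _ cont \<open>0 \<le> c\<close>])
    show "(\<lambda>t. t) \<in> borel_measurable (lebesgue_on E)"
      by (intro measurable_restrict_space1 measurable_completion) simp
    show "emeasure (lebesgue_on E) {x \<in> space (lebesgue_on E). x \<le> s} = ennreal (F s)" for s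
    proof -
      have "emeasure (lebesgue_on E) {x \<in> space (lebesgue_on E). x \<le> s} = emeasure lebesgue (E \<inter> {..s})"
        using E by (subst emeasure_restrict_space) (auto intro!: arg_cong[of _ _ "emeasure lebesgue"])
      then show ?thesis
        using lm[of s] by (simp add: F_def emeasure_eq_measure2)
    qed
  qed (use E in \<open>auto simp: F_def\<close>)
  then show "emeasure lebesgue {t \<in> E. measure lebesgue (E \<inter> {..t}) \<le> c} = min (ennreal c) (emeasure lebesgue E)"
    using E by (simp add: F_def emeasure_restrict_space)
qed

text \<open>Half-lines generate the Borel sets and are stable under intersection, so the
  distribution function determines the image measure. It is Lebesgue measure on
  \<open>(0, L)\<close>, written with \<open>ennreal t < L\<close> because \<open>L\<close> may be
  infinite.\<close>

lemma distr_eq_of_cdf: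
  fixes g :: "'a \<Rightarrow> real"
  assumes [measurable]: "g \<in> borel_measurable M" and nonneg: "\<And>x. x \<in> space M \<Longrightarrow> 0 \<le> g x"
    and cdf: "\<And>a. 0 \<le> a \<Longrightarrow> emeasure M {x \<in> space M. g x \<le> a} = min (ennreal a) L"
  shows "distr M borel g = density lborel (indicator {t. 0 < t \<and> ennreal t < L})"
proof (rule measure_eqI_generator_eq)
  let ?E = "range (\<lambda>a::real. {..a})"
  have D: "emeasure (distr M borel g) {..a} = min (ennreal a) L" for a
  proof -
    have "emeasure (distr M borel g) {..a} = emeasure M {x \<in> space M. g x \<le> a}"
      by (subst emeasure_distr) (auto intro!: arg_cong[of _ _ "emeasure M"])
    also have "\<dots> = min (ennreal a) L"
    proof (cases "0 \<le> a")
      case False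
      then have "{x \<in> space M. g x \<le> a} = {}"
        using nonneg by fastforce
      then have "emeasure M {x \<in> space M. g x \<le> a} = 0"
        by (simp only: emeasure_empty)
      then show ?thesis
        using False by (simp add: ennreal_neg min_def)
    qed (rule cdf)
    finally show ?thesis .
  qed
  show "Int_stable ?E"
    by (auto simp: Int_stable_def intro!: exI[of _ "min a b" for a b])
  show "sets (distr M borel g) = sigma_sets UNIV ?E"
    by (simp add: borel_eq_atMost)
  show "sets (density lborel (indicator {t. 0 < t \<and> ennreal t < L})) = sigma_sets UNIV ?E"
    by (simp add: borel_eq_atMost)
  show "range (\<lambda>n::nat. {..real n}) \<subseteq> ?E"
    by auto
  show "(\<Union>n::nat. {..real n}) = UNIV"
    using real_arch_simple by auto
  show "emeasure (distr M borel g) {..real n} \<noteq> \<infinity>" for n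
    by (auto simp: D min_def top_unique)
  fix X assume "X \<in> ?E"
  then obtain a where X: "X = {..a}" by auto
  have "emeasure (density lborel (indicator {t. 0 < t \<and> ennreal t < L})) X
      = emeasure lborel {t. 0 < t \<and> ennreal t < L \<and> t \<le> a}"
    unfolding X by (subst emeasure_density)
      (auto simp: indicator_inter_arith[symmetric] Int_def intro!: arg_cong[of _ _ "emeasure lborel"])
  also have "\<dots> = min (ennreal a) L"
  proof (cases "ennreal a < L")
    case True
    then have eq: "{t. 0 < t \<and> ennreal t < L \<and> t \<le> a} = {0<..a}"
      by (auto intro: le_less_trans[of "ennreal t" "ennreal a" for t] ennreal_leI)
    show ?thesis
      unfolding eq using True by (cases "0 \<le> a") (auto simp: min_def ennreal_neg)
  next
    case False
    then obtain r where r: "L = ennreal r" "0 \<le> r"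
      by (cases L) auto
    then have "{t. 0 < t \<and> ennreal t < L \<and> t \<le> a} = {0<..<r}"
      using False by (auto simp: ennreal_less_iff not_less ennreal_le_iff2)
    moreover have "min (ennreal a) L = L"
      using False by (intro min.absorb2) (simp add: not_less)
    ultimately show ?thesis
      using r by simp
  qed
  finally show "emeasure (distr M borel g) X = emeasure (density lborel (indicator {t. 0 < t \<and> ennreal t < L})) X"
    by (simp add: X D)
qed auto

lemma emeasure_vimage_of_cdf:
  fixes g :: "'a \<Rightarrow> real"
  assumes [measurable]: "g \<in> borel_measurable M" and "\<And>x. x \<in> space M \<Longrightarrow> 0 \<le> g x"
    and "\<And>a. 0 \<le> a \<Longrightarrow> emeasure M {x \<in> space M. g x \<le> a} = min (ennreal a) L" "B \<in> sets borel"
  shows "emeasure M (g -` B \<inter> space M) = emeasure lborel ({t. 0 < t \<and> ennreal t < L} \<inter> B)"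
proof -
  have "emeasure M (g -` B \<inter> space M) = emeasure (distr M borel g) B"
    using assms(4) by (subst emeasure_distr) auto
  also have "\<dots> = emeasure (density lborel (indicator {t. 0 < t \<and> ennreal t < L})) B"
    using distr_eq_of_cdf[OF assms(1-3)] by simp
  also have "\<dots> = emeasure lborel ({t. 0 < t \<and> ennreal t < L} \<inter> B)"
    using assms(4) by (simp add: emeasure_density indicator_inter_arith[symmetric])
  finally show ?thesis .
qed

text \<open>On Borel sets the image measure is determined by the distribution function. A Lebesgue
  measurable set is a Borel set up to a subset of a Borel null set, and the preimage of the latter
  is null by the Borel case.\<close>

lemma measure_preserving_of_cdf:
  assumes g: "g \<in> L0" "\<And>t. t \<in> I \<Longrightarrow> 0 < g t"
    and cdf: "\<And>a. 0 \<le> a \<Longrightarrow> emeasure (lebesgue_on I) {t \<in> space (lebesgue_on I). g t \<le> a} = ennreal a"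
  shows "measure_preserving_map g"
  unfolding measure_preserving_map_def
proof (intro conjI ballI impI)
  have borel: "g -` B \<inter> I \<in> sets lebesgue" "emeasure lebesgue (g -` B \<inter> I) = emeasure lborel (I \<inter> B)"
    if "B \<in> sets borel" for B
  proof -
    show "g -` B \<inter> I \<in> sets lebesgue"
      using measurable_sets[OF g(1) that] by (auto simp: sets_restrict_space_iff)
    have "emeasure (lebesgue_on I) (g -` B \<inter> space (lebesgue_on I)) = emeasure lborel ({t. 0 < t \<and> ennreal t < \<infinity>} \<inter> B)"
      using that g cdf by (intro emeasure_vimage_of_cdf) (auto intro: less_imp_le)
    moreover have "{t. 0 < t \<and> ennreal t < \<infinity>} = I"
      by auto
    ultimately show "emeasure lebesgue (g -` B \<inter> I) = emeasure lborel (I \<inter> B)"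
      by (simp add: emeasure_lebesgue_on_I)
  qed
  fix A :: "real set" assume "A \<in> sets lebesgue" "A \<subseteq> I"
  then obtain S N N' where A: "A = S \<union> N" "N \<subseteq> N'" "N' \<in> null_sets lborel" "S \<in> sets lborel"
    by (auto elim: sets_completionE)
  have "emeasure lebesgue (g -` N' \<inter> I) \<le> emeasure lborel N'"
    using A(3) borel(2)[of N'] emeasure_mono[of "I \<inter> N'" N' lborel] by (auto simp: null_sets_def)
  then have "g -` N' \<inter> I \<in> null_sets lebesgue"
    using A(3) borel(1)[of N'] by (auto simp: null_sets_def)
  then have N: "g -` N \<inter> I \<in> null_sets lebesgue"
    by (rule null_sets_completion_subset[rotated]) (use A(2) in auto)
  have eq: "g -` A \<inter> I = (g -` S \<inter> I) \<union> (g -` N \<inter> I)"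
    using A(1) by auto
  show "g -` A \<inter> I \<in> sets lebesgue"
    unfolding eq using N A(4) sets.Un[OF borel(1)[of S] null_setsD2[OF N]] by simp
  have "emeasure lebesgue (g -` A \<inter> I) = emeasure lebesgue (g -` S \<inter> I)"
    unfolding eq using N A(4) by (intro emeasure_Un_null_set borel(1)) auto
  also have "\<dots> = emeasure lborel S"
  proof -
    have "I \<inter> S = S"
      using A(1) \<open>A \<subseteq> I\<close> by auto
    then show ?thesis
      using borel(2)[of S] A(4) by simp
  qed
  also have "\<dots> = emeasure lebesgue A"
  proof -
    have "N \<in> null_sets lebesgue"
      using A(2,3) by (meson null_sets_completionI null_sets_completion_subset)
    then have "emeasure lebesgue (S \<union> N) = emeasure lebesgue S"
      using A(4) by (intro emeasure_Un_null_set) auto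
    then show ?thesis
      using A by simp
  qed
  finally show "emeasure lebesgue (g -` A \<inter> I) = emeasure lebesgue A" .
qed (use g in auto)

section \<open>The rank of a point and its uniform distribution\<close>

definition finite_distr :: "(real \<Rightarrow> real) \<Rightarrow> bool" where
  "finite_distr f \<longleftrightarrow> f \<in> L0 \<and> (\<forall>s>0. fun_distr f s < \<infinity>)"

text \<open>Ryff's rank: ties on the level sets of \<open>\<bar>f\<bar>\<close> are broken by position.\<close>

definition ryff_rank :: "(real \<Rightarrow> real) \<Rightarrow> real \<Rightarrow> real" where
  "ryff_rank f t = enn2real (fun_distr f \<bar>f t\<bar>) + measure lebesgue ({u \<in> I. \<bar>f u\<bar> = \<bar>f t\<bar>} \<inter> {..t})"

lemma rank_nonneg: "0 \<le> ryff_rank f t"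
  by (simp add: ryff_rank_def)

lemma L0_level_sets:
  assumes "f \<in> L0"
  shows "{t \<in> I. s < \<bar>f t\<bar>} \<in> sets lebesgue" "{t \<in> I. s \<le> \<bar>f t\<bar>} \<in> sets lebesgue"
    "{t \<in> I. \<bar>f t\<bar> = s} \<in> sets lebesgue" "{t \<in> I. f t \<noteq> 0} \<in> sets lebesgue" "{t \<in> I. f t = 0} \<in> sets lebesgue"
proof -
  note [measurable] = assms
  have *: "A \<in> sets lebesgue" if "A \<in> sets (lebesgue_on I)" for A :: "real set"
    using that by (simp add: sets_restrict_space_iff)
  have "{t \<in> space (lebesgue_on I). s < \<bar>f t\<bar>} \<in> sets (lebesgue_on I)"
    "{t \<in> space (lebesgue_on I). s \<le> \<bar>f t\<bar>} \<in> sets (lebesgue_on I)"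
    "{t \<in> space (lebesgue_on I). \<bar>f t\<bar> = s} \<in> sets (lebesgue_on I)"
    "{t \<in> space (lebesgue_on I). f t \<noteq> 0} \<in> sets (lebesgue_on I)"
    "{t \<in> space (lebesgue_on I). f t = 0} \<in> sets (lebesgue_on I)"
    by (measurable, measurable, measurable, measurable, measurable)
  from this[THEN *, unfolded space_lebesgue_on_I] show "{t \<in> I. s < \<bar>f t\<bar>} \<in> sets lebesgue" "{t \<in> I. s \<le> \<bar>f t\<bar>} \<in> sets lebesgue"
    "{t \<in> I. \<bar>f t\<bar> = s} \<in> sets lebesgue" "{t \<in> I. f t \<noteq> 0} \<in> sets lebesgue" "{t \<in> I. f t = 0} \<in> sets lebesgue"
    .
qed

text \<open>The rank adds up the measures of \<open>{|f| > |f t|}\<close> and of a part of the level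
  set through \<open>t\<close>, which are disjoint subsets of the closed superlevel set. As
  \<open>f t\<close> is nonzero, the first measure is finite and \<open>enn2real\<close> loses
  nothing.\<close>

lemma rank_le_closed_level:
  assumes "finite_distr f" "f t \<noteq> 0"
  shows "ennreal (ryff_rank f t) \<le> emeasure lebesgue {u \<in> I. \<bar>f t\<bar> \<le> \<bar>f u\<bar>}"
proof -
  have f: "f \<in> L0" and fin: "fun_distr f \<bar>f t\<bar> < \<infinity>"
    using assms by (auto simp: finite_distr_def)
  note sets = L0_level_sets[OF f]
  let ?E = "{u \<in> I. \<bar>f u\<bar> = \<bar>f t\<bar>}"
  have "ennreal (ryff_rank f t) = emeasure lebesgue {u \<in> I. \<bar>f t\<bar> < \<bar>f u\<bar>} + emeasure lebesgue (?E \<inter> {..t})"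
  proof -
    have "ennreal (ryff_rank f t) = fun_distr f \<bar>f t\<bar> + ennreal (measure lebesgue (?E \<inter> {..t}))"
      using fin unfolding ryff_rank_def by (subst ennreal_plus) auto
    moreover have "?E \<inter> {..t} \<in> lmeasurable"
      by (rule Int_atMost_lmeasurable[OF sets(3)]) auto
    ultimately show ?thesis
      by (simp add: emeasure_eq_measure2 fun_distr_def)
  qed
  also have "\<dots> = emeasure lebesgue ({u \<in> I. \<bar>f t\<bar> < \<bar>f u\<bar>} \<union> (?E \<inter> {..t}))"
  proof (rule plus_emeasure[OF sets(1) fmeasurableD[OF Int_atMost_lmeasurable[OF sets(3)]]])
    show "{u \<in> I. \<bar>f t\<bar> < \<bar>f u\<bar>} \<inter> (?E \<inter> {..t}) = {}"
      by auto
  qed auto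
  also have "\<dots> \<le> emeasure lebesgue {u \<in> I. \<bar>f t\<bar> \<le> \<bar>f u\<bar>}"
    by (rule emeasure_mono[OF _ sets(2)]) auto
  finally show ?thesis .
qed

text \<open>The left limit of the distribution function at \<open>s\<close> is the measure of the
  closed superlevel set. Continuity from above is available because positive levels have finite
  measure; the sequence \<open>u\<close> therefore starts at half of \<open>s\<close>.\<close>

lemma closed_level_ge:
  assumes f: "finite_distr f" and "0 < s" and *: "\<And>u. 0 < u \<Longrightarrow> u < s \<Longrightarrow> a \<le> fun_distr f u"
  shows "a \<le> emeasure lebesgue {t \<in> I. s \<le> \<bar>f t\<bar>}"
proof -
  have f0: "f \<in> L0"
    using f by (simp add: finite_distr_def)
  define u where "u n = s - s * (inverse (real (Suc n)) / 2)" for n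
  have inv: "0 < inverse (real (Suc n))" "inverse (real (Suc n)) \<le> 1" for n
    by (auto simp: field_simps)
  have u: "0 < u n" "u n < s" for n
    using \<open>0 < s\<close> by (auto simp: u_def field_simps intro: add_pos_nonneg)
  have "u \<longlonglongrightarrow> s - s * (0 / 2)"
    unfolding u_def by (intro tendsto_intros LIMSEQ_inverse_real_of_nat) simp
  then have lim: "u \<longlonglongrightarrow> s"
    by simp
  have "incseq u"
    unfolding incseq_def u_def using \<open>0 < s\<close> by (auto intro!: mult_left_mono le_imp_inverse_le)
  have "(\<Inter>n. {t \<in> I. u n < \<bar>f t\<bar>}) = {t \<in> I. s \<le> \<bar>f t\<bar>}"
  proof (intro equalityI subsetI)
    fix t assume "t \<in> (\<Inter>n. {t \<in> I. u n < \<bar>f t\<bar>})"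
    then have "t \<in> I" "\<And>n. u n \<le> \<bar>f t\<bar>"
      by (auto intro: less_imp_le)
    then show "t \<in> {t \<in> I. s \<le> \<bar>f t\<bar>}"
      using LIMSEQ_le_const2[OF lim] by auto
  qed (use u in \<open>auto intro: less_le_trans\<close>)
  moreover have "(INF n. emeasure lebesgue {t \<in> I. u n < \<bar>f t\<bar>}) = emeasure lebesgue (\<Inter>n. {t \<in> I. u n < \<bar>f t\<bar>})"
  proof (rule INF_emeasure_decseq)
    show "decseq (\<lambda>n. {t \<in> I. u n < \<bar>f t\<bar>})"
      using \<open>incseq u\<close> by (auto simp: decseq_def incseq_def intro: le_less_trans)
    show "emeasure lebesgue {t \<in> I. u n < \<bar>f t\<bar>} \<noteq> \<infinity>" for n
      using f u(1)[of n] by (auto simp: finite_distr_def fun_distr_def less_top[symmetric])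
  next
    show "range (\<lambda>n. {t \<in> I. u n < \<bar>f t\<bar>}) \<subseteq> sets lebesgue"
      by (rule image_subsetI, rule L0_level_sets[OF f0])
  qed
  moreover have "a \<le> (INF n. emeasure lebesgue {t \<in> I. u n < \<bar>f t\<bar>})"
    using *[OF u] by (intro INF_greatest) (simp add: fun_distr_def)
  ultimately show ?thesis
    by simp
qed

text \<open>The superlevel sets of a real-valued \<open>f\<close> shrink to the empty set. Hence
  \<open>f*\<close> can be infinite at a point \<open>a \<ge> 0\<close> only if
  \<open>a = 0\<close>.\<close>

lemma fun_distr_unbounded_zero:
  assumes f: "finite_distr f" and *: "\<And>s. 0 \<le> s \<Longrightarrow> ennreal a \<le> fun_distr f s"
  shows "ennreal a = 0"
proof -
  have f0: "f \<in> L0"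
    using f by (simp add: finite_distr_def)
  have "(\<Inter>n. {t \<in> I. real (Suc n) < \<bar>f t\<bar>}) = {}"
  proof -
    have "\<not> (\<forall>n. real (Suc n) < \<bar>f t\<bar>)" for t
    proof -
      obtain n where "\<bar>f t\<bar> \<le> real n"
        using real_arch_simple by blast
      then have "\<not> real (Suc n) < \<bar>f t\<bar>"
        by simp
      then show ?thesis by blast
    qed
    then show ?thesis by blast
  qed
  moreover have "(INF n. emeasure lebesgue {t \<in> I. real (Suc n) < \<bar>f t\<bar>})
      = emeasure lebesgue (\<Inter>n. {t \<in> I. real (Suc n) < \<bar>f t\<bar>})"
  proof (rule INF_emeasure_decseq)
    show "decseq (\<lambda>n. {t \<in> I. real (Suc n) < \<bar>f t\<bar>})"
      by (auto simp: decseq_def)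
    show "emeasure lebesgue {t \<in> I. real (Suc n) < \<bar>f t\<bar>} \<noteq> \<infinity>" for n
    proof -
      have "fun_distr f (real (Suc n)) < \<infinity>"
        using f of_nat_0_less_iff[of "Suc n"] unfolding finite_distr_def by blast
      then show ?thesis
        unfolding fun_distr_def by simp
    qed
  next
    show "range (\<lambda>n. {t \<in> I. real (Suc n) < \<bar>f t\<bar>}) \<subseteq> sets lebesgue"
      by (rule image_subsetI, rule L0_level_sets[OF f0])
  qed
  moreover have "ennreal a \<le> (INF n. emeasure lebesgue {t \<in> I. real (Suc n) < \<bar>f t\<bar>})"
    by (intro INF_greatest) (simp only: fun_distr_def[symmetric], intro *, simp)
  ultimately show ?thesis
    by (simp only: emeasure_empty) simp
qed

text \<open>For \<open>a\<close> below the measure of the support, put \<open>s = f* a\<close>. Then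
  \<open>{|f| > s}\<close> has measure at most \<open>a\<close> and \<open>{|f| \<ge> s}\<close> at
  least \<open>a\<close>. If \<open>s\<close> is finite, the points of rank at most \<open>a\<close>
  are the former set together with an initial portion, of the missing measure, of the plateau
  \<open>{|f| = s}\<close>.\<close>

lemma rank_cdf:
  assumes f: "finite_distr f" and "0 \<le> a"
  defines "S \<equiv> {t \<in> I. f t \<noteq> 0}"
  shows "{t \<in> S. ryff_rank f t \<le> a} \<in> sets lebesgue
    \<and> emeasure lebesgue {t \<in> S. ryff_rank f t \<le> a} = min (ennreal a) (emeasure lebesgue S)"
proof -
  have f0: "f \<in> L0" and fin: "\<And>s. 0 < s \<Longrightarrow> fun_distr f s < \<infinity>"
    using f by (auto simp: finite_distr_def)
  note sets = L0_level_sets[OF f0]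
  have S: "S \<in> sets lebesgue" "emeasure lebesgue S = fun_distr f 0"
    unfolding S_def fun_distr_def using sets(4) by (auto intro!: arg_cong[of _ _ "emeasure lebesgue"])
  show ?thesis
  proof (cases "ennreal a < emeasure lebesgue S")
    case False
    have "ryff_rank f t \<le> a" if "t \<in> S" for t
    proof -
      have "ennreal (ryff_rank f t) \<le> emeasure lebesgue {u \<in> I. \<bar>f t\<bar> \<le> \<bar>f u\<bar>}"
        using that by (intro rank_le_closed_level f) (auto simp: S_def)
      also have "\<dots> \<le> emeasure lebesgue S"
        using that S(1) by (intro emeasure_mono) (auto simp: S_def)
      also have "\<dots> \<le> ennreal a"
        using False by simp
      finally have "ennreal (ryff_rank f t) \<le> ennreal a" .
      then show ?thesis
        using \<open>0 \<le> a\<close> by simp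
    qed
    then have "{t \<in> S. ryff_rank f t \<le> a} = S"
      by auto
    then show ?thesis
      using S(1) False by (simp add: min_def)
  next
    case True
    have rank_gt: "a < ryff_rank f t" if "t \<in> S" "ennreal a < fun_distr f \<bar>f t\<bar>" for t
    proof -
      have "fun_distr f \<bar>f t\<bar> < top"
        using that(1) fin[of "\<bar>f t\<bar>"] by (auto simp: S_def)
      then have "a < enn2real (fun_distr f \<bar>f t\<bar>)"
        using that(2) \<open>0 \<le> a\<close> by (cases "fun_distr f \<bar>f t\<bar>") (auto simp: ennreal_less_iff)
      then show ?thesis
        unfolding ryff_rank_def
        using measure_nonneg[of lebesgue "{u \<in> I. \<bar>f u\<bar> = \<bar>f t\<bar>} \<inter> {..t}"] by linarith
    qed
    show ?thesis
    proof (cases "fun_rearr f a")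
      case top
      then have *: "ennreal a < fun_distr f s" if "0 \<le> s" for s
        using less_fun_rearr_iff[OF f0 that, of a] by simp
      then have "{t \<in> S. ryff_rank f t \<le> a} = {}"
        using rank_gt by (fastforce simp: not_le[symmetric])
      moreover have "ennreal a = 0"
        using * by (intro fun_distr_unbounded_zero[OF f]) (auto intro: less_imp_le)
      ultimately show ?thesis
        by (simp only: emeasure_empty) simp
    next
      case (real s)
      have less_iff: "u < s \<longleftrightarrow> ennreal a < fun_distr f u" if "0 \<le> u" for u
        using less_fun_rearr_iff[OF f0 that, of a] real that by (simp add: ennreal_less_iff)
      have "0 < s"
        using True S(2) less_iff[of 0] by simp
      define E where "E = {u \<in> I. \<bar>f u\<bar> = s}"
      define G where "G = enn2real (fun_distr f s)"
      have G: "fun_distr f s = ennreal G" "0 \<le> G"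
        using fin[OF \<open>0 < s\<close>] by (auto simp: G_def)
      have "G \<le> a"
        using less_iff[of s] \<open>0 < s\<close> G \<open>0 \<le> a\<close> by (simp add: ennreal_less_iff not_less)
      have E: "E \<in> sets lebesgue" "E \<subseteq> I"
        using sets(3)[of s] by (auto simp: E_def)
      have "ennreal a \<le> emeasure lebesgue {t \<in> I. s \<le> \<bar>f t\<bar>}"
        using less_iff by (intro closed_level_ge[OF f \<open>0 < s\<close>]) (auto intro: less_imp_le)
      also have "{t \<in> I. s \<le> \<bar>f t\<bar>} = {t \<in> I. s < \<bar>f t\<bar>} \<union> E"
        by (auto simp: E_def)
      also have "emeasure lebesgue \<dots> = ennreal G + emeasure lebesgue E"
        unfolding G(1)[symmetric] fun_distr_def
      proof (rule plus_emeasure[symmetric, OF sets(1) E(1)])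
        show "{t \<in> I. s < \<bar>f t\<bar>} \<inter> E = {}"
          by (auto simp: E_def)
      qed
      finally have mass: "ennreal (a - G) \<le> emeasure lebesgue E"
        using G(2) by (simp add: ennreal_minus[symmetric] ennreal_minus_le_iff)
      let ?L = "{t \<in> E. measure lebesgue (E \<inter> {..t}) \<le> a - G}"
      have L: "?L \<in> sets lebesgue" "emeasure lebesgue ?L = ennreal (a - G)"
        using emeasure_position_le[OF E, of "a - G"] mass \<open>G \<le> a\<close> by (auto simp: min_def)
      have eq: "{t \<in> S. ryff_rank f t \<le> a} = {t \<in> I. s < \<bar>f t\<bar>} \<union> ?L"
      proof (intro equalityI subsetI)
        fix t assume t: "t \<in> {t \<in> S. ryff_rank f t \<le> a}"
        then have "\<not> \<bar>f t\<bar> < s"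
          using rank_gt[of t] less_iff[of "\<bar>f t\<bar>"] by auto
        moreover have "t \<in> ?L" if "\<bar>f t\<bar> = s"
          using t that by (auto simp: S_def E_def ryff_rank_def G_def)
        ultimately show "t \<in> {t \<in> I. s < \<bar>f t\<bar>} \<union> ?L"
          using t by (auto simp: S_def)
      next
        fix t assume "t \<in> {t \<in> I. s < \<bar>f t\<bar>} \<union> ?L"
        then consider "t \<in> I" "s < \<bar>f t\<bar>" | "t \<in> ?L"
          by auto
        then show "t \<in> {t \<in> S. ryff_rank f t \<le> a}"
        proof cases
          case 1
          then have "ennreal (ryff_rank f t) \<le> emeasure lebesgue {u \<in> I. \<bar>f t\<bar> \<le> \<bar>f u\<bar>}"
            using \<open>0 < s\<close> by (intro rank_le_closed_level f) auto
          also have "\<dots> \<le> ennreal G"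
            unfolding G(1)[symmetric] fun_distr_def
          proof (rule emeasure_mono[OF _ sets(1)])
            show "{u \<in> I. \<bar>f t\<bar> \<le> \<bar>f u\<bar>} \<subseteq> {u \<in> I. s < \<bar>f u\<bar>}"
              using 1(2) by auto
          qed
          finally have "ryff_rank f t \<le> a"
            using \<open>G \<le> a\<close> G(2) by simp
          then show ?thesis
            using 1 \<open>0 < s\<close> by (auto simp: S_def)
        next
          case 2
          then show ?thesis
            using \<open>0 < s\<close> by (auto simp: S_def E_def ryff_rank_def G_def)
        qed
      qed
      have "emeasure lebesgue ({t \<in> I. s < \<bar>f t\<bar>} \<union> ?L) = ennreal G + ennreal (a - G)"
        unfolding L(2)[symmetric] G(1)[symmetric] fun_distr_def
      proof (rule plus_emeasure[symmetric, OF sets(1) L(1)])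
        show "{t \<in> I. s < \<bar>f t\<bar>} \<inter> ?L = {}"
          by (auto simp: E_def)
      qed
      also have "\<dots> = ennreal a"
        using G(2) \<open>G \<le> a\<close> by (simp add: ennreal_plus[symmetric] del: ennreal_plus)
      finally show ?thesis
        unfolding eq using L(1) sets(1)[of s] True by (auto simp: min_def)
    qed
  qed
qed

lemma measurable_rank:
  assumes "finite_distr f"
  shows "ryff_rank f \<in> borel_measurable (lebesgue_on {t \<in> I. f t \<noteq> 0})"
  unfolding borel_measurable_iff_le
proof
  have S: "{t \<in> I. f t \<noteq> 0} \<in> sets lebesgue"
    using assms by (intro L0_level_sets) (simp add: finite_distr_def)
  fix a
  show "{t \<in> space (lebesgue_on {t \<in> I. f t \<noteq> 0}). ryff_rank f t \<le> a} \<in> sets (lebesgue_on {t \<in> I. f t \<noteq> 0})"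
  proof (cases "0 \<le> a")
    case True
    then show ?thesis
      unfolding space_lebesgue_on using rank_cdf[OF assms True] S
      by (subst sets_restrict_space_iff) (simp_all add: subset_iff)
  next
    case False
    then have "{t \<in> space (lebesgue_on {t \<in> I. f t \<noteq> 0}). ryff_rank f t \<le> a} = {}"
      using rank_nonneg[of f] by (auto simp: not_le intro: less_le_trans)
    then show ?thesis
      by (simp only: sets.empty_sets)
  qed
qed

lemma rank_cdf_lebesgue_on:
  assumes "finite_distr f" "0 \<le> a"
  shows "emeasure (lebesgue_on {t \<in> I. f t \<noteq> 0}) {t \<in> space (lebesgue_on {t \<in> I. f t \<noteq> 0}). ryff_rank f t \<le> a}
    = min (ennreal a) (emeasure lebesgue {t \<in> I. f t \<noteq> 0})"
proof -
  have S: "{t \<in> I. f t \<noteq> 0} \<in> sets lebesgue"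
    using assms by (intro L0_level_sets) (simp add: finite_distr_def)
  show ?thesis
    unfolding space_lebesgue_on using rank_cdf[OF assms] S
    by (subst emeasure_restrict_space) (simp_all add: subset_iff)
qed

text \<open>The distribution of the rank has a density, hence no atoms.\<close>

lemma AE_rank_notin_countable:
  assumes "finite_distr f" "countable C"
  shows "AE t in lebesgue_on {t \<in> I. f t \<noteq> 0}. ryff_rank f t \<notin> C"
proof (rule AE_I)
  let ?M = "lebesgue_on {t \<in> I. f t \<noteq> 0}"
  have C: "C \<in> sets borel" "emeasure lborel C = 0"
    using assms(2) by (auto simp: countable_imp_null_set_lborel emeasure_lborel_countable intro: sets.countable)
  show "emeasure ?M (ryff_rank f -` C \<inter> space ?M) = 0"
  proof -
    have "emeasure ?M (ryff_rank f -` C \<inter> space ?M) = emeasure lborel ({t. 0 < t \<and> ennreal t < emeasure lebesgue {t \<in> I. f t \<noteq> 0}} \<inter> C)"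
      by (rule emeasure_vimage_of_cdf[OF measurable_rank[OF assms(1)] rank_nonneg rank_cdf_lebesgue_on[OF assms(1)] C(1)])
    also have "\<dots> \<le> emeasure lborel C"
      using C(1) by (intro emeasure_mono) auto
    finally show ?thesis
      using C(2) by simp
  qed
  show "ryff_rank f -` C \<inter> space ?M \<in> sets ?M"
    using measurable_rank[OF assms(1)] C(1) by (rule measurable_sets)
qed auto

text \<open>If \<open>f*\<close> at the rank of \<open>t\<close> were below \<open>|f t|\<close>, a
  rational \<open>q\<close> strictly between would force the rank to equal
  \<open>fun_distr f q\<close>, since \<open>{|f| \<ge> |f t|}\<close> is contained in
  \<open>{|f| > q}\<close>. These countably many values are avoided almost everywhere.\<close>

lemma AE_le_rearr_rank:
  assumes "finite_distr f"
  shows "AE t in lebesgue_on {t \<in> I. f t \<noteq> 0}. ennreal \<bar>f t\<bar> \<le> fun_rearr f (ryff_rank f t)"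
proof -
  let ?M = "lebesgue_on {t \<in> I. f t \<noteq> 0}"
  have f0: "f \<in> L0" and fin: "\<And>s. 0 < s \<Longrightarrow> fun_distr f s < \<infinity>"
    using assms by (auto simp: finite_distr_def)
  note sets = L0_level_sets[OF f0]
  have "AE t in ?M. ryff_rank f t \<notin> (\<lambda>q. enn2real (fun_distr f q)) ` \<rat>"
    by (intro AE_rank_notin_countable assms countable_image countable_rat)
  moreover have "AE t in ?M. t \<in> space ?M"
    by (rule AE_space)
  ultimately show ?thesis
  proof eventually_elim
    case (elim t)
    then have t: "t \<in> I" "f t \<noteq> 0"
      by auto
    show ?case
    proof (rule ccontr)
      assume "\<not> ?case"
      then obtain r where r: "fun_rearr f (ryff_rank f t) = ennreal r" "0 \<le> r" "r < \<bar>f t\<bar>"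
        by (cases "fun_rearr f (ryff_rank f t)") (auto simp: not_le ennreal_less_iff)
      then obtain q where q: "q \<in> \<rat>" "r < q" "q < \<bar>f t\<bar>"
        using Rats_dense_in_real by blast
      have "0 < q"
        using r q by simp
      have "\<not> ennreal q < fun_rearr f (ryff_rank f t)"
        using r q by (simp add: ennreal_less_iff)
      then have "fun_distr f q \<le> ennreal (ryff_rank f t)"
        using less_fun_rearr_iff[OF f0, of q "ryff_rank f t"] \<open>0 < q\<close> by (simp add: not_less)
      moreover have "ennreal (ryff_rank f t) \<le> fun_distr f q"
      proof -
        have "ennreal (ryff_rank f t) \<le> emeasure lebesgue {u \<in> I. \<bar>f t\<bar> \<le> \<bar>f u\<bar>}"
          using t by (intro rank_le_closed_level assms) auto
        also have "\<dots> \<le> fun_distr f q"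
          unfolding fun_distr_def using sets(1)[of q] q by (intro emeasure_mono) auto
        finally show ?thesis .
      qed
      ultimately have "ryff_rank f t = enn2real (fun_distr f q)"
        using rank_nonneg[of f t] by (metis antisym enn2real_ennreal)
      then show False
        using elim(1) q(1) by auto
    qed
  qed
qed

lemma rank_sublevel:
  assumes f: "finite_distr f"
  shows "{t \<in> {t \<in> I. f t \<noteq> 0}. ryff_rank f t \<le> s} \<in> sets lebesgue
    \<and> emeasure lebesgue {t \<in> {t \<in> I. f t \<noteq> 0}. ryff_rank f t \<le> s} = min (ennreal s) (emeasure lebesgue {t \<in> I. f t \<noteq> 0})"
proof (cases "0 \<le> s")
  case False
  then have "\<not> ryff_rank f t \<le> s" for t
    using rank_nonneg[of f t] by linarith
  then have eq: "{t \<in> {t \<in> I. f t \<noteq> 0}. ryff_rank f t \<le> s} = {}"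
    by blast
  show ?thesis
    unfolding eq using False by (simp add: ennreal_neg)
qed (rule rank_cdf[OF f])

lemma position_sublevel:
  assumes E: "E \<in> sets lebesgue" "E \<subseteq> I"
  shows "{t \<in> E. T + measure lebesgue (E \<inter> {..t}) \<le> s} \<in> sets lebesgue
    \<and> emeasure lebesgue {t \<in> E. T + measure lebesgue (E \<inter> {..t}) \<le> s} = min (ennreal (s - T)) (emeasure lebesgue E)"
proof (cases "0 \<le> s - T")
  case True
  have "T + m \<le> s \<longleftrightarrow> m \<le> s - T" for m :: real
    by auto
  then show ?thesis
    using emeasure_position_le[OF E True] by simp
next
  case False
  then have "\<not> T + measure lebesgue (E \<inter> {..t}) \<le> s" for t
    using measure_nonneg[of lebesgue "E \<inter> {..t}"] by linarith
  then have eq: "{t \<in> E. T + measure lebesgue (E \<inter> {..t}) \<le> s} = {}"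
    by blast
  show ?thesis
    unfolding eq using False by (simp add: ennreal_neg)
qed

lemma min_ennreal_add_le:
  assumes "s \<le> t"
  shows "min (ennreal t) L \<le> min (ennreal s) L + ennreal (t - s)"
proof -
  have "ennreal t \<le> ennreal s + ennreal (t - s)"
  proof (cases "0 \<le> s")
    case True
    then show ?thesis
      using assms by (simp add: ennreal_plus[symmetric] del: ennreal_plus)
  next
    case False
    then show ?thesis
      by (simp add: ennreal_neg ennreal_leI)
  qed
  moreover have "L \<le> L + ennreal (t - s)"
    by simp
  ultimately show ?thesis
    by (auto simp: min_def intro: order_trans)
qed

text \<open>The support of \<open>f\<close> is ordered by \<open>ryff_rank f\<close>, and its complement is merged into this order after
  time \<open>T\<close> by position; \<open>\<sigma>\<close> is the ryff_rank in the merged order. Hence positions up to \<open>T\<close> are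
  unchanged, and the later ones are at most doubled.\<close>

lemma merged_rank:
  assumes f: "finite_distr f" and "0 \<le> T"
  obtains \<sigma> where "measure_preserving_map \<sigma>"
    "AE t in lebesgue_on {t \<in> I. f t \<noteq> 0}. \<sigma> t \<le> (if ryff_rank f t \<le> T then ryff_rank f t else 2 * ryff_rank f t)"
proof -
  have f0: "f \<in> L0"
    using f by (simp add: finite_distr_def)
  define S where "S = {t \<in> I. f t \<noteq> 0}"
  define Z where "Z = {t \<in> I. f t = 0}"
  have S: "S \<in> sets lebesgue" "S \<subseteq> I" and Z: "Z \<in> sets lebesgue" "Z \<subseteq> I"
    unfolding S_def Z_def by (rule L0_level_sets[OF f0] Collect_restrict)+
  define \<psi> where "\<psi> t = (if f t \<noteq> 0 then ryff_rank f t else T + measure lebesgue (Z \<inter> {..t}))" for t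
  \<comment> \<open>The distribution function of \<psi>: the support supplies mass at unit rate from
    time 0 and the zeros from time \<open>T\<close>, each until it is exhausted.\<close>
  define Fe where "Fe s = min (ennreal s) (emeasure lebesgue S) + min (ennreal (s - T)) (emeasure lebesgue Z)" for s
  define F where "F s = enn2real (Fe s)" for s
  have Fe_le: "Fe s \<le> ennreal s + ennreal (s - T)" for s
    unfolding Fe_def by (intro add_mono) auto
  then have F: "Fe s = ennreal (F s)" for s
    using le_less_trans[of "Fe s" "ennreal s + ennreal (s - T)" top] by (simp add: F_def)
  have F_nonneg: "0 \<le> F s" for s
    by (simp add: F_def)
  have \<psi>_sublevel: "{t \<in> I. \<psi> t \<le> s} \<in> sets lebesgue \<and> emeasure lebesgue {t \<in> I. \<psi> t \<le> s} = ennreal (F s)" for s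
  proof -
    have eq: "{t \<in> I. \<psi> t \<le> s} = {t \<in> S. ryff_rank f t \<le> s} \<union> {t \<in> Z. T + measure lebesgue (Z \<inter> {..t}) \<le> s}"
      by (auto simp: S_def Z_def \<psi>_def)
    note A = rank_sublevel[OF f, of s, folded S_def]
    note B = position_sublevel[OF Z, of T s]
    have "emeasure lebesgue {t \<in> I. \<psi> t \<le> s} = Fe s"
      unfolding eq Fe_def A[THEN conjunct2, symmetric] B[THEN conjunct2, symmetric]
    proof (rule plus_emeasure[symmetric, OF A[THEN conjunct1] B[THEN conjunct1]])
      show "{t \<in> S. ryff_rank f t \<le> s} \<inter> {t \<in> Z. T + measure lebesgue (Z \<inter> {..t}) \<le> s} = {}"
        by (auto simp: S_def Z_def)
    qed
    then show ?thesis
      unfolding F using sets.Un[OF A[THEN conjunct1] B[THEN conjunct1]] by (simp only: eq)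
  qed
  have \<psi>_cdf: "emeasure (lebesgue_on I) {t \<in> space (lebesgue_on I). \<psi> t \<le> s} = ennreal (F s)" for s
    unfolding space_lebesgue_on_I using \<psi>_sublevel[of s] by (subst emeasure_lebesgue_on_I) (auto simp del: greaterThan_iff)
  have \<psi>: "\<psi> \<in> L0"
    unfolding borel_measurable_iff_le space_lebesgue_on_I
    using \<psi>_sublevel by (subst sets_restrict_space_iff) (simp_all add: subset_iff)
  have \<psi>_nonneg: "0 \<le> \<psi> t" for t
    using \<open>0 \<le> T\<close> by (simp add: \<psi>_def rank_nonneg)
  have cont: "continuous_on UNIV F"
  proof (rule continuous_on_of_real_lipschitz)
    fix s t :: real assume st: "s \<le> t"
    have "Fe s \<le> Fe t"
      unfolding Fe_def using st by (intro add_mono min.mono ennreal_leI) auto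
    then show "F s \<le> F t"
      unfolding F using F_nonneg by simp
    have "Fe t \<le> (min (ennreal s) (emeasure lebesgue S) + ennreal (t - s))
        + (min (ennreal (s - T)) (emeasure lebesgue Z) + ennreal (t - s))"
      unfolding Fe_def using min_ennreal_add_le[OF st] min_ennreal_add_le[of "s - T" "t - T"] st
      by (intro add_mono) auto
    also have "\<dots> = Fe s + ennreal (2 * (t - s))"
    proof -
      have "ennreal (2 * (t - s)) = ennreal (t - s) + ennreal (t - s)"
        using st by (subst ennreal_plus[symmetric]) auto
      then show ?thesis
        unfolding Fe_def by (simp only: add_ac)
    qed
    also have "\<dots> = ennreal (F s + 2 * (t - s))"
      unfolding F by (rule ennreal_plus[symmetric]) (use st F_nonneg[of s] in auto)
    finally have "ennreal (F t) \<le> ennreal (F s + 2 * (t - s))"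
      unfolding F .
    then show "F t \<le> F s + 2 * (t - s)"
      by (rule ennreal_le_iff[THEN iffD1, rotated]) (use st F_nonneg[of s] in auto)
  qed simp
  then have [measurable]: "F \<in> borel_measurable borel"
    by (rule borel_measurable_continuous_onI)
  \<comment> \<open>With infinite total mass the minimum in the transform disappears, and
    \<open>F \<circ> \<psi>\<close> is uniform on all of \<open>I\<close>.\<close>
  have I_top: "emeasure (lebesgue_on I) (space (lebesgue_on I)) = top"
  proof -
    have "{t \<in> I. ennreal t < top} = I"
      by auto
    then show ?thesis
      using emeasure_initial_interval[of top]
      by (simp only: space_lebesgue_on_I emeasure_lebesgue_on_I[OF order_refl])
  qed
  have cdf0: "emeasure (lebesgue_on I) {t \<in> space (lebesgue_on I). F (\<psi> t) \<le> a} = ennreal a" if "0 \<le> a" for a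
    using emeasure_cdf_transform[OF \<psi> \<psi>_nonneg \<psi>_cdf F_nonneg cont that] unfolding I_top by simp
  \<comment> \<open>The map has to take its values in \<open>I\<close>; the value 0 occurs only on a
    null set and is replaced by 1.\<close>
  define \<sigma> where "\<sigma> t = (if 0 < F (\<psi> t) then F (\<psi> t) else 1)" for t
  have F\<psi> [measurable]: "(\<lambda>t. F (\<psi> t)) \<in> L0"
    using \<psi> by measurable
  have \<sigma>_meas [measurable]: "\<sigma> \<in> L0"
    unfolding \<sigma>_def by measurable
  have AE_\<sigma>: "AE t in lebesgue_on I. \<sigma> t = F (\<psi> t)"
  proof (rule AE_I)
    show "{t \<in> space (lebesgue_on I). \<sigma> t \<noteq> F (\<psi> t)} \<subseteq> {t \<in> space (lebesgue_on I). F (\<psi> t) \<le> 0}"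
      by (auto simp: \<sigma>_def)
    show "{t \<in> space (lebesgue_on I). F (\<psi> t) \<le> 0} \<in> sets (lebesgue_on I)"
      by measurable
  qed (simp only: cdf0[of 0, OF order_refl] ennreal_0)
  have "measure_preserving_map \<sigma>"
  proof (rule measure_preserving_of_cdf[OF \<sigma>_meas])
    show "0 < \<sigma> t" for t
      by (simp add: \<sigma>_def)
    fix a :: real assume "0 \<le> a"
    have "emeasure (lebesgue_on I) {t \<in> space (lebesgue_on I). \<sigma> t \<le> a}
        = emeasure (lebesgue_on I) {t \<in> space (lebesgue_on I). F (\<psi> t) \<le> a}"
    proof (rule emeasure_eq_AE)
      show "AE t in lebesgue_on I. (t \<in> {t \<in> space (lebesgue_on I). \<sigma> t \<le> a}) = (t \<in> {t \<in> space (lebesgue_on I). F (\<psi> t) \<le> a})"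
        using AE_\<sigma> by eventually_elim (simp only: mem_Collect_eq)
      show "{t \<in> space (lebesgue_on I). \<sigma> t \<le> a} \<in> sets (lebesgue_on I)"
        by measurable
      show "{t \<in> space (lebesgue_on I). F (\<psi> t) \<le> a} \<in> sets (lebesgue_on I)"
        by measurable
    qed
    then show "emeasure (lebesgue_on I) {t \<in> space (lebesgue_on I). \<sigma> t \<le> a} = ennreal a"
      using cdf0[OF \<open>0 \<le> a\<close>] by simp
  qed
  moreover have "AE t in lebesgue_on {t \<in> I. f t \<noteq> 0}. \<sigma> t \<le> (if ryff_rank f t \<le> T then ryff_rank f t else 2 * ryff_rank f t)"
  proof -
    have bound: "F s \<le> (if s \<le> T then s else 2 * s)" if "0 \<le> s" for s
    proof -
      have "ennreal (F s) \<le> ennreal s + ennreal (s - T)"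
        using Fe_le[of s] F by simp
      also have "\<dots> \<le> ennreal (if s \<le> T then s else 2 * s)"
        using that \<open>0 \<le> T\<close>
        by (auto simp: ennreal_neg ennreal_plus[symmetric] simp del: ennreal_plus intro!: ennreal_leI)
      finally show ?thesis
        using that by (auto split: if_splits)
    qed
    have "AE t in lebesgue. t \<in> I \<longrightarrow> \<sigma> t = F (\<psi> t)"
      using AE_\<sigma> by (subst (asm) AE_restrict_space_iff) auto
    then have "AE t in lebesgue. t \<in> S \<longrightarrow> \<sigma> t = F (\<psi> t)"
      by (rule eventually_mono) (use S(2) in blast)
    then have "AE t in lebesgue_on S. \<sigma> t = F (\<psi> t)"
      using S(1) by (subst AE_restrict_space_iff) simp_all
    moreover have "AE t in lebesgue_on S. t \<in> space (lebesgue_on S)"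
      by (rule AE_space)
    ultimately show ?thesis
      unfolding S_def[symmetric]
    proof eventually_elim
      case (elim t)
      then have "\<psi> t = ryff_rank f t"
        by (simp add: \<psi>_def S_def)
      then show ?case
        using elim(1) bound[OF rank_nonneg, of f t] by simp
    qed
  qed
  ultimately show ?thesis
    by (rule that)
qed

text \<open>The rank spreads the support uniformly over an initial interval of \<open>I\<close>,
  which may be a proper one; hence only an inequality.\<close>

lemma nn_integral_rank_le:
  assumes f: "finite_distr f" and [measurable]: "h \<in> borel_measurable borel"
  shows "(\<integral>\<^sup>+t. h (ryff_rank f t) \<partial>lebesgue_on {t \<in> I. f t \<noteq> 0}) \<le> (\<integral>\<^sup>+t. h t \<partial>lebesgue_on I)"
proof -
  let ?S = "{t \<in> I. f t \<noteq> 0}"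
  let ?L = "{t. 0 < t \<and> ennreal t < emeasure lebesgue ?S}"
  have "(\<integral>\<^sup>+t. h (ryff_rank f t) \<partial>lebesgue_on ?S) = (\<integral>\<^sup>+t. h t \<partial>distr (lebesgue_on ?S) borel (ryff_rank f))"
    using measurable_rank[OF f] by (subst nn_integral_distr) auto
  also have "\<dots> = (\<integral>\<^sup>+t. indicator ?L t * h t \<partial>lborel)"
  proof -
    have "distr (lebesgue_on ?S) borel (ryff_rank f) = density lborel (indicator ?L)"
      by (rule distr_eq_of_cdf[OF measurable_rank[OF f] rank_nonneg rank_cdf_lebesgue_on[OF f]])
    then show ?thesis
      by (simp only:) (rule nn_integral_density, measurable)
  qed
  also have "\<dots> \<le> (\<integral>\<^sup>+t. h t * indicator I t \<partial>lborel)"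
    by (intro nn_integral_mono) (auto simp: indicator_def)
  also have "\<dots> = (\<integral>\<^sup>+t. h t \<partial>lebesgue_on I)"
    by (subst nn_integral_restrict_space) (auto simp: nn_integral_completion)
  finally show ?thesis .
qed

text \<open>The measure with density \<open>h\<close> is finite, so its values on the rays beyond
  \<open>n\<close>, which decrease to the empty set, tend to 0.\<close>

lemma nn_integral_tail:
  assumes [measurable]: "h \<in> borel_measurable (lebesgue_on I)"
    and fin: "(\<integral>\<^sup>+t. h t \<partial>lebesgue_on I) < \<infinity>" and "0 < e"
  obtains n :: nat where "(\<integral>\<^sup>+t. h t * indicator {real n<..} t \<partial>lebesgue_on I) < e"
proof -
  let ?D = "density (lebesgue_on I) h"
  define A where "A n = {t \<in> space (lebesgue_on I). real n < t}" for n
  have id [measurable]: "(\<lambda>t. t) \<in> borel_measurable (lebesgue_on I)"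
    by (rule L0_of_borel) simp
  have A [measurable]: "A n \<in> sets (lebesgue_on I)" for n
    unfolding A_def by measurable
  have D: "emeasure ?D (A n) = (\<integral>\<^sup>+t. h t * indicator {real n<..} t \<partial>lebesgue_on I)" for n
  proof -
    have "emeasure ?D (A n) = (\<integral>\<^sup>+t. h t * indicator (A n) t \<partial>lebesgue_on I)"
      by (rule emeasure_density) measurable
    also have "\<dots> = (\<integral>\<^sup>+t. h t * indicator {real n<..} t \<partial>lebesgue_on I)"
      by (intro nn_integral_cong) (auto simp: A_def indicator_def)
    finally show ?thesis .
  qed
  have "(\<Inter>n. A n) = {}"
  proof -
    have "\<not> (\<forall>n. real n < t)" for t
      using real_arch_simple[of t] by (auto simp: not_less)
    then show ?thesis
      by (auto simp: A_def)
  qed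
  moreover have "(INF n. emeasure ?D (A n)) = emeasure ?D (\<Inter>n. A n)"
  proof (rule INF_emeasure_decseq)
    show "decseq A"
      by (auto simp: decseq_def A_def)
    have "emeasure ?D (A n) \<le> (\<integral>\<^sup>+t. h t \<partial>lebesgue_on I)" for n
      unfolding D by (intro nn_integral_mono) (auto simp: indicator_def)
    then show "emeasure ?D (A n) \<noteq> \<infinity>" for n
      using fin by (metis infinity_ennreal_def top_unique less_irrefl)
  qed auto
  ultimately have "(INF n. emeasure ?D (A n)) < e"
    using \<open>0 < e\<close> by simp
  then obtain n where "emeasure ?D (A n) < e"
    by (auto simp: INF_less_iff)
  then show ?thesis
    unfolding D by (rule that)
qed

text \<open>The values of \<open>w\<close> outside \<open>I\<close> are arbitrary. Replacing them by
  1 gives a positive Borel function on the line, which can be composed with ranks and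
  dilations.\<close>

lemma weight_borel_extension:
  assumes w: "pos_weight_fun w"
  obtains w' where "w' \<in> borel_measurable borel" "\<And>t. 0 < w' t" "\<And>t. 0 < t \<Longrightarrow> w' t = w t"
proof -
  have "(\<lambda>t. - w t) \<in> borel_measurable (restrict_space borel I)"
    by (rule borel_measurable_mono_on_fnc) (use w in \<open>auto simp: monotone_on_def pos_weight_fun_def\<close>)
  then have "w \<in> borel_measurable (restrict_space borel {t. 0 < t})"
    by (simp add: greaterThan_def)
  then have "(\<lambda>t. if 0 < t then w t else 1) \<in> borel_measurable borel"
    by (subst measurable_If_restrict_space_iff) auto
  then show ?thesis
    by (rule that) (use w in \<open>auto simp: pos_weight_fun_def\<close>)
qed

section \<open>Near-optimal maps for functions\<close>

context orlicz
begin

text \<open>If some positive level had infinite measure, \<open>f*\<close> would exceed it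
  everywhere, and beyond \<open>t = 1\<close> the integrand would be at least the positive constant
  taken at \<open>s\<close> and \<open>w 2\<close>.\<close>

lemma finite_distr_of_integral:
  assumes w: "pos_weight_fun w" and f: "f \<in> L0"
    and Q: "(\<integral>\<^sup>+t. orlicz_term \<phi> (fun_rearr f t) (w (2 * t)) \<partial>lebesgue_on I) < \<infinity>"
  shows "finite_distr f"
  unfolding finite_distr_def
proof (intro conjI f allI impI)
  fix s :: real assume "0 < s"
  show "fun_distr f s < \<infinity>"
  proof (rule ccontr)
    assume "\<not> fun_distr f s < \<infinity>"
    then have top: "fun_distr f s = top"
      by (simp add: less_top[symmetric])
    define c where "c = orlicz_term \<phi> (ennreal s) (w 2)"
    have "0 < c"
      unfolding c_def using w \<open>0 < s\<close> by (intro term_pos) (auto simp: pos_weight_fun_def)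
    have le: "c \<le> orlicz_term \<phi> (fun_rearr f t) (w (2 * t))" if "1 < t" for t
    proof -
      have "ennreal s < fun_rearr f t"
        using \<open>0 < s\<close> top by (simp add: less_fun_rearr_iff[OF f])
      moreover have "0 < w (2 * t)" "w (2 * t) \<le> w 2"
        using w that by (auto simp: pos_weight_fun_def monotone_on_def)
      ultimately show ?thesis
        unfolding c_def by (meson less_imp_le order_trans term_mono term_antimono)
    qed
    have "emeasure lebesgue {1::real<..} = top"
    proof -
      have "of_nat n \<le> emeasure lebesgue {1::real<..}" for n
      proof -
        have "emeasure lebesgue {1<..<real n + 1} \<le> emeasure lebesgue {1::real<..}"
          by (rule emeasure_mono) auto
        then show ?thesis
          by (simp add: ennreal_of_nat_eq_real_of_nat)
      qed
      then show ?thesis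
        by (metis ennreal_SUP_of_nat_eq_top SUP_least top_unique)
    qed
    then have "top = (\<integral>\<^sup>+t. c * indicator {1::real<..} t \<partial>lebesgue)"
      using \<open>0 < c\<close> by (subst nn_integral_cmult_indicator) (auto simp: ennreal_mult_top)
    also have "\<dots> \<le> (\<integral>\<^sup>+t. orlicz_term \<phi> (fun_rearr f t) (w (2 * t)) * indicator I t \<partial>lebesgue)"
      using le by (intro nn_integral_mono) (auto simp: indicator_def)
    also have "\<dots> = (\<integral>\<^sup>+t. orlicz_term \<phi> (fun_rearr f t) (w (2 * t)) \<partial>lebesgue_on I)"
      by (subst nn_integral_restrict_space) auto
    also note Q
    finally show False by simp
  qed
qed

text \<open>Zeros of \<open>f\<close> cost nothing, so only the support counts. There
  \<open>|f t|\<close> is at most \<open>f*\<close> at the rank, and the weight at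
  \<open>\<sigma> t\<close> is at least the one at the rank, or at twice the rank beyond
  \<open>n\<close>. Uniformity of the rank turns this bound into an integral over
  \<open>I\<close>.\<close>

lemma fun_integral_near_optimal:
  assumes w: "pos_weight_fun w" and f: "f \<in> L0"
    and Q: "(\<integral>\<^sup>+t. orlicz_term \<phi> (fun_rearr f t) (w (2 * t)) \<partial>lebesgue_on I) < \<infinity>" and "0 < e"
  shows "\<exists>\<sigma>. measure_preserving_map \<sigma> \<and> fun_integral \<phi> (w \<circ> \<sigma>) f \<le> fun_M \<phi> w f + e"
proof -
  have fd: "finite_distr f"
    by (rule finite_distr_of_integral[OF w f Q])
  have wpos: "0 < w t" if "0 < t" for t
    using w that by (simp add: pos_weight_fun_def)
  have wanti: "w t \<le> w s" if "0 < s" "s \<le> t" for s t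
    using w that by (simp add: pos_weight_fun_def monotone_on_def)
  obtain w' where [measurable]: "w' \<in> borel_measurable borel"
    and w'_pos: "\<And>t. 0 < w' t" and w': "\<And>t. 0 < t \<Longrightarrow> w' t = w t"
    using weight_borel_extension[OF w] by blast
  have [measurable]: "fun_rearr f \<in> borel_measurable borel"
    using f by (rule measurable_fun_rearr)
  define h1 where "h1 t = orlicz_term \<phi> (fun_rearr f t) (w' t)" for t
  define h2 where "h2 t = orlicz_term \<phi> (fun_rearr f t) (w' (2 * t))" for t
  have h1 [measurable]: "h1 \<in> borel_measurable borel"
    unfolding h1_def using w'_pos by measurable
  have h2 [measurable]: "h2 \<in> borel_measurable borel"
    unfolding h2_def using w'_pos by measurable
  have h1_int: "(\<integral>\<^sup>+t. h1 t \<partial>lebesgue_on I) = fun_M \<phi> w f"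
    unfolding fun_M_eq h1_def by (intro nn_integral_cong) (simp add: w')
  have "(\<integral>\<^sup>+t. h2 t \<partial>lebesgue_on I) = (\<integral>\<^sup>+t. orlicz_term \<phi> (fun_rearr f t) (w (2 * t)) \<partial>lebesgue_on I)"
    unfolding h2_def by (intro nn_integral_cong) (simp add: w')
  then obtain n :: nat where n: "(\<integral>\<^sup>+t. h2 t * indicator {real n<..} t \<partial>lebesgue_on I) < e"
    using nn_integral_tail[OF L0_of_borel[OF h2] _ \<open>0 < e\<close>] Q by auto
  obtain \<sigma> where \<sigma>: "measure_preserving_map \<sigma>"
    and \<sigma>_le: "AE t in lebesgue_on {t \<in> I. f t \<noteq> 0}. \<sigma> t \<le> (if ryff_rank f t \<le> real n then ryff_rank f t else 2 * ryff_rank f t)"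
    by (rule merged_rank[OF fd, of "real n"]) auto
  let ?S = "{t \<in> I. f t \<noteq> 0}"
  have S: "?S \<in> sets lebesgue"
    by (rule L0_level_sets[OF f])
  \<comment> \<open>Ranks up to \<open>n\<close> are charged to \<open>h1\<close>, the doubled ones
    to \<open>h2\<close>; leaving \<open>h1\<close> in place beyond \<open>n\<close> only enlarges
    the bound and makes its integral \<open>fun_M\<close> plus a tail.\<close>
  define K where "K u = h1 u + h2 u * indicator {real n<..} u" for u
  have [measurable]: "K \<in> borel_measurable borel"
    unfolding K_def by measurable
  have "fun_integral \<phi> (w \<circ> \<sigma>) f = (\<integral>\<^sup>+t. orlicz_term \<phi> (ennreal \<bar>f t\<bar>) (w (\<sigma> t)) * indicator I t \<partial>lebesgue)"
    unfolding fun_integral_eq by (subst nn_integral_restrict_space) auto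
  also have "\<dots> = (\<integral>\<^sup>+t. orlicz_term \<phi> (ennreal \<bar>f t\<bar>) (w (\<sigma> t)) * indicator ?S t \<partial>lebesgue)"
    by (intro nn_integral_cong) (auto simp: indicator_def phi_0)
  also have "\<dots> = (\<integral>\<^sup>+t. orlicz_term \<phi> (ennreal \<bar>f t\<bar>) (w (\<sigma> t)) \<partial>lebesgue_on ?S)"
    using S by (subst nn_integral_restrict_space) simp_all
  also have "\<dots> \<le> (\<integral>\<^sup>+t. K (ryff_rank f t) \<partial>lebesgue_on ?S)"
  proof (rule nn_integral_mono_AE)
    \<comment> \<open>Rank 0 has to be excluded, since \<open>w'\<close> is known to agree with
      \<open>w\<close> only at positive arguments.\<close>
    have "AE t in lebesgue_on ?S. ryff_rank f t \<notin> {0}"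
      by (rule AE_rank_notin_countable[OF fd]) simp
    moreover have "AE t in lebesgue_on ?S. t \<in> space (lebesgue_on ?S)"
      by (rule AE_space)
    ultimately show "AE t in lebesgue_on ?S. orlicz_term \<phi> (ennreal \<bar>f t\<bar>) (w (\<sigma> t)) \<le> K (ryff_rank f t)"
      using \<sigma>_le AE_le_rearr_rank[OF fd]
    proof eventually_elim
      case (elim t)
      have "0 < ryff_rank f t"
        using elim(1) rank_nonneg[of f t] by simp
      have "0 < \<sigma> t"
        using elim(2) \<sigma> by (auto simp: measure_preserving_map_def)
      define p where "p = (if ryff_rank f t \<le> real n then ryff_rank f t else 2 * ryff_rank f t)"
      have "orlicz_term \<phi> (ennreal \<bar>f t\<bar>) (w (\<sigma> t)) \<le> orlicz_term \<phi> (fun_rearr f (ryff_rank f t)) (w (\<sigma> t))"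
        using elim(4) wpos[OF \<open>0 < \<sigma> t\<close>] by (rule term_mono)
      also have "\<dots> \<le> orlicz_term \<phi> (fun_rearr f (ryff_rank f t)) (w p)"
        using elim(3) \<open>0 < \<sigma> t\<close> by (intro term_antimono wpos wanti) (auto simp: p_def split: if_splits)
      also have "\<dots> \<le> K (ryff_rank f t)"
        using \<open>0 < ryff_rank f t\<close> by (auto simp: p_def K_def h1_def h2_def w' indicator_def)
      finally show ?case .
    qed
  qed
  also have "\<dots> \<le> (\<integral>\<^sup>+t. K t \<partial>lebesgue_on I)"
    by (rule nn_integral_rank_le[OF fd]) measurable
  also have "\<dots> = (\<integral>\<^sup>+t. h1 t \<partial>lebesgue_on I) + (\<integral>\<^sup>+t. h2 t * indicator {real n<..} t \<partial>lebesgue_on I)"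
    unfolding K_def by (rule nn_integral_add) (rule L0_of_borel, measurable)+
  also have "\<dots> \<le> fun_M \<phi> w f + e"
    unfolding h1_int using n by (intro add_left_mono less_imp_le)
  finally show ?thesis
    using \<sigma> by blast
qed

end

subsection \<open>Dilations and controlled weights\<close>

text \<open>Preimages of superlevel sets of \<open>w\<close> keep their measure, so
  \<open>w \<circ> \<sigma>\<close> competes in the infimum over all \<open>v\<close>.\<close>

lemma measure_preserving_weight:
  assumes w: "pos_weight_fun w" and \<sigma>: "measure_preserving_map \<sigma>"
  shows "w \<circ> \<sigma> \<in> L0" "fun_equidistr (w \<circ> \<sigma>) w" "\<forall>t\<in>I. 0 < (w \<circ> \<sigma>) t"
proof -
  have \<sigma>_I: "\<sigma> t \<in> I" if "t \<in> I" for t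
    using \<sigma> that by (auto simp: measure_preserving_map_def)
  have mp: "\<sigma> -` A \<inter> I \<in> sets lebesgue" "emeasure lebesgue (\<sigma> -` A \<inter> I) = emeasure lebesgue A"
    if "A \<in> sets lebesgue" "A \<subseteq> I" for A
    using \<sigma> that unfolding measure_preserving_map_def by blast+
  have wL: "w \<in> L0"
    using w by (simp add: pos_weight_fun_def L0_antimono_on)
  have "\<sigma> \<in> measurable (lebesgue_on I) (lebesgue_on I)"
  proof (rule measurableI)
    fix A assume "A \<in> sets (lebesgue_on I)"
    then have A: "A \<in> sets lebesgue" "A \<subseteq> I"
      by (auto simp: sets_restrict_space_iff)
    then have "\<sigma> -` A \<inter> I \<in> sets lebesgue"
      by (rule mp(1))
    then show "\<sigma> -` A \<inter> space (lebesgue_on I) \<in> sets (lebesgue_on I)"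
      unfolding space_lebesgue_on_I by (subst sets_restrict_space_iff) auto
  qed (simp only: space_lebesgue_on_I \<sigma>_I)
  then show L: "w \<circ> \<sigma> \<in> L0"
    using wL by (rule measurable_comp)
  show "fun_equidistr (w \<circ> \<sigma>) w"
    unfolding fun_equidistr_iff[OF L wL]
  proof (intro allI impI)
    fix s :: real
    have "{t \<in> I. s < \<bar>(w \<circ> \<sigma>) t\<bar>} = \<sigma> -` {t \<in> I. s < \<bar>w t\<bar>} \<inter> I"
      using \<sigma>_I by (auto simp del: greaterThan_iff)
    moreover have "emeasure lebesgue (\<sigma> -` {t \<in> I. s < \<bar>w t\<bar>} \<inter> I) = emeasure lebesgue {t \<in> I. s < \<bar>w t\<bar>}"
      by (rule mp(2)[OF L0_level_sets(1)[OF wL] Collect_restrict])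
    ultimately show "fun_distr (w \<circ> \<sigma>) s = fun_distr w s"
      by (simp only: fun_distr_def)
  qed
  show "\<forall>t\<in>I. 0 < (w \<circ> \<sigma>) t"
    using w \<sigma>_I by (auto simp: pos_weight_fun_def simp del: greaterThan_iff)
qed

text \<open>Superlevel sets are stretched by the factor 2, which doubles the distribution function
  and so halves the argument of the rearrangement.\<close>

lemma fun_rearr_D2: "fun_rearr (fun_D2 f) t = fun_rearr f (t / 2)"
proof -
  have distr: "fun_distr (fun_D2 f) s = 2 * fun_distr f s" for s
  proof -
    have "{t \<in> I. s < \<bar>fun_D2 f t\<bar>} = (\<lambda>x. 2 *\<^sub>R x + 0) ` {t \<in> I. s < \<bar>f t\<bar>}"
    proof (intro equalityI subsetI)
      fix t assume "t \<in> {t \<in> I. s < \<bar>fun_D2 f t\<bar>}"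
      then show "t \<in> (\<lambda>x. 2 *\<^sub>R x + 0) ` {t \<in> I. s < \<bar>f t\<bar>}"
        by (intro image_eqI[of _ _ "t / 2"]) (auto simp: fun_D2_def)
    qed (auto simp: fun_D2_def)
    then show ?thesis
      unfolding fun_distr_def by (simp only: emeasure_lebesgue_affine) simp
  qed
  have "2 * a \<le> ennreal t \<longleftrightarrow> a \<le> ennreal (t / 2)" for a
  proof (cases a)
    case (real r)
    then have "2 * a = ennreal (2 * r)"
      by (simp add: ennreal_mult)
    then show ?thesis
      using real by (cases "0 \<le> t") (auto simp: ennreal_le_iff ennreal_neg)
  qed (auto simp: ennreal_mult_top top_unique)
  then show ?thesis
    unfolding fun_rearr_def distr by simp
qed

text \<open>The term at \<open>j\<close> is repeated at the places \<open>2 * j - 1\<close> and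
  \<open>2 * j\<close>, so \<open>k + 1\<close> terms of \<open>x\<close> above a level yield
  \<open>2 * k + 2\<close> terms of the dilation above it.\<close>

lemma seq_rearr_D2: "seq_rearr x (Suc k) \<le> seq_rearr (seq_D2 x) (2 * Suc k)"
proof (rule ccontr)
  assume "\<not> ?thesis"
  then have less: "seq_rearr (seq_D2 x) (2 * Suc k) < seq_rearr x (Suc k)"
    by simp
  then obtain s where s: "seq_rearr (seq_D2 x) (2 * Suc k) = ennreal s" "0 \<le> s"
    by (cases "seq_rearr (seq_D2 x) (2 * Suc k)") auto
  let ?A = "{j \<in> {1..}. s < \<bar>x j\<bar>}"
  have k: "of_nat k < seq_distr x s"
    using less less_seq_rearr_iff[OF s(2), of x "Suc k"] s(1) by simp
  \<comment> \<open>The superlevel set may be infinite, so exactly \<open>k + 1\<close> of its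
    indices are taken to keep cardinalities finite.\<close>
  obtain B where B: "B \<subseteq> ?A" "finite B" "card B = Suc k"
  proof (cases "finite ?A")
    case True
    then have "Suc k \<le> card ?A"
      using k by (simp add: seq_distr_card)
    then show ?thesis
      using that True by (meson obtain_subset_with_card_n finite_subset)
  next
    case False
    then show ?thesis
      using that infinite_arbitrarily_large[OF False] by metis
  qed
  let ?E = "(\<lambda>j. 2 * j) ` B" and ?O = "(\<lambda>j. 2 * j - 1) ` B"
  have pos: "1 \<le> j" if "j \<in> B" for j
    using B(1) that by auto
  have "?E \<inter> ?O = {}"
  proof -
    have "2 * i \<noteq> 2 * j - 1" if "j \<in> B" for i j
      using pos[OF that] by presburger
    then show ?thesis
      by blast
  qed
  then have "card (?E \<union> ?O) = card ?E + card ?O"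
    using B(2) by (intro card_Un_disjoint) auto
  moreover have "card ?E = card B"
    by (intro card_image inj_onI) simp
  moreover have "card ?O = card B"
  proof (intro card_image inj_onI)
    fix i j assume "i \<in> B" "j \<in> B" "2 * i - 1 = 2 * j - 1"
    then show "i = j"
      using pos[of i] pos[of j] by simp
  qed
  ultimately have card: "card (?E \<union> ?O) = 2 * Suc k"
    using B(3) by simp
  have sub: "?E \<union> ?O \<subseteq> {n \<in> {1..}. s < \<bar>seq_D2 x n\<bar>}"
  proof
    fix n assume "n \<in> ?E \<union> ?O"
    then obtain j where j: "j \<in> B" "n = 2 * j \<or> n = 2 * j - 1"
      by auto
    then have "1 \<le> j" "s < \<bar>x j\<bar>"
      using B(1) by auto
    moreover have "\<lceil>real n / 2\<rceil> = int j"
      using j(2) \<open>1 \<le> j\<close> by (intro ceiling_unique) (auto simp: of_nat_diff)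
    ultimately show "n \<in> {n \<in> {1..}. s < \<bar>seq_D2 x n\<bar>}"
      using j(2) by (auto simp: seq_D2_def)
  qed
  have "(of_nat (2 * Suc k - 1) :: ennreal) < of_nat (card (?E \<union> ?O))"
    unfolding card of_nat_less_iff by simp
  also have "\<dots> = emeasure (count_space {1..}) (?E \<union> ?O)"
    using sub B(2) by (subst emeasure_count_space) auto
  also have "\<dots> \<le> seq_distr (seq_D2 x) s"
    unfolding seq_distr_def using sub by (intro emeasure_mono) auto
  finally show False
    using less_seq_rearr_iff[OF s(2), of "seq_D2 x" "2 * Suc k"] s(1) by simp
qed

lemma automorphism_weight:
  assumes w: "pos_weight_seq w" and \<sigma>: "bij_betw \<sigma> {1..} {1..}"
  shows "seq_equidistr (w \<circ> \<sigma>) w" "\<forall>n\<ge>1. 0 < (w \<circ> \<sigma>) n"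
proof -
  have \<sigma>_I: "1 \<le> \<sigma> n" if "1 \<le> n" for n
    using bij_betwE[OF \<sigma>] that by auto
  show "seq_equidistr (w \<circ> \<sigma>) w"
    unfolding seq_equidistr_iff
  proof (intro allI impI)
    fix s :: real
    have "bij_betw \<sigma> {k \<in> {1..}. s < \<bar>(w \<circ> \<sigma>) k\<bar>} {k \<in> {1..}. s < \<bar>w k\<bar>}"
    proof (rule bij_betw_subset[OF \<sigma>])
      show "\<sigma> ` {k \<in> {1..}. s < \<bar>(w \<circ> \<sigma>) k\<bar>} = {k \<in> {1..}. s < \<bar>w k\<bar>}"
      proof (intro equalityI subsetI)
        fix k assume "k \<in> {k \<in> {1..}. s < \<bar>w k\<bar>}"
        moreover from this obtain j where "j \<in> {1..}" "k = \<sigma> j"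
          using bij_betw_imp_surj_on[OF \<sigma>] by (metis (no_types, lifting) imageE mem_Collect_eq)
        ultimately show "k \<in> \<sigma> ` {k \<in> {1..}. s < \<bar>(w \<circ> \<sigma>) k\<bar>}"
          by auto
      qed (use \<sigma>_I in auto)
    qed auto
    from bij_betw_finite[OF this] bij_betw_same_card[OF this]
    show "seq_distr (w \<circ> \<sigma>) s = seq_distr w s"
      unfolding seq_distr_card by (simp only:)
  qed
  show "\<forall>n\<ge>1. 0 < (w \<circ> \<sigma>) n"
    using w \<sigma>_I by (auto simp: pos_weight_seq_def)
qed

text \<open>In a sum counted from 0, the odd indices \<open>2 * k + 1\<close> are the even places
  \<open>2 * Suc k\<close> of a sequence counted from 1.\<close>

lemma suminf_odd_le:
  fixes b :: "nat \<Rightarrow> ennreal"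
  shows "(\<Sum>k. b (2 * k + 1)) \<le> (\<Sum>n. b n)"
  unfolding suminf_eq_SUP[of "\<lambda>k. b (2 * k + 1)"]
proof (rule SUP_least)
  fix m
  have "(\<Sum>k<m. b (2 * k + 1)) = sum b ((\<lambda>k. 2 * k + 1) ` {..<m})"
    by (subst sum.reindex) (auto simp: inj_on_def)
  also have "\<dots> \<le> (\<Sum>n. b n)"
    by (rule sum_le_suminf) auto
  finally show "(\<Sum>k<m. b (2 * k + 1)) \<le> (\<Sum>n. b n)" .
qed

section \<open>Finiteness hypotheses and the two infima\<close>

context orlicz
begin

text \<open>Control speaks of positive reals \<open>c\<close>, whereas rearrangements also take the
  values 0 and infinity; there both sides are 0 or infinite, respectively.\<close>

lemma term_le_controlled:
  assumes "0 < K" "0 < b" "\<And>c. 0 < c \<Longrightarrow> \<phi> (c / b') * b' \<le> K * (\<phi> (c / b) * b)"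
  shows "orlicz_term \<phi> a b' \<le> ennreal K * orlicz_term \<phi> a b"
proof (cases a)
  case (real r)
  show ?thesis
  proof (cases "r = 0")
    case False
    then have "\<phi> (r / b') * b' \<le> K * (\<phi> (r / b) * b)"
      using real by (intro assms(3)) simp
    then have "ennreal (\<phi> (r / b') * b') \<le> ennreal (K * (\<phi> (r / b) * b))"
      by (rule ennreal_leI)
    also have "\<dots> = ennreal K * ennreal (\<phi> (r / b) * b)"
      using real assms by (intro ennreal_mult mult_nonneg_nonneg phi_nonneg) auto
    finally show ?thesis
      using real by simp
  qed (use real in simp)
qed (use assms in \<open>simp add: ennreal_mult_top\<close>)

text \<open>The lower bound, admissibility of \<open>w \<circ> \<sigma>\<close> and near-optimality
  close the circle of inequalities. The premise asks for a finite integral only if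
  \<open>fun_M\<close> is finite: otherwise the last comparison is trivial, and control could not
  provide more.\<close>

lemma fun_M_eq_INF:
  assumes w: "pos_weight_fun w" and f: "f \<in> L0"
    and Q: "fun_M \<phi> w f < \<infinity> \<Longrightarrow> (\<integral>\<^sup>+t. orlicz_term \<phi> (fun_rearr f t) (w (2 * t)) \<partial>lebesgue_on I) < \<infinity>"
  shows "fun_M \<phi> w f = (INF v\<in>{v \<in> L0. fun_equidistr v w \<and> (\<forall>t\<in>I. 0 < v t)}. fun_integral \<phi> v f) \<and>
    (INF v\<in>{v \<in> L0. fun_equidistr v w \<and> (\<forall>t\<in>I. 0 < v t)}. fun_integral \<phi> v f)
      = (INF \<sigma>\<in>{\<sigma>. measure_preserving_map \<sigma>}. fun_integral \<phi> (w \<circ> \<sigma>) f)"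
    (is "?M = ?V \<and> ?V = ?S")
proof -
  have "?M \<le> ?V"
    using fun_M_le_fun_integral[OF w f] by (intro INF_greatest) auto
  moreover have "?V \<le> ?S"
    using measure_preserving_weight[OF w] by (intro INF_greatest INF_lower) blast
  moreover have "?S \<le> ?M"
  proof (rule ennreal_le_epsilon)
    fix e :: real assume "?M < top" "0 < e"
    then obtain \<sigma> where "measure_preserving_map \<sigma>" "fun_integral \<phi> (w \<circ> \<sigma>) f \<le> ?M + ennreal e"
      using fun_integral_near_optimal[OF w f Q, of "ennreal e"] by auto
    then show "?S \<le> ?M + ennreal e"
      by (intro INF_lower2[of \<sigma>]) auto
  qed
  ultimately show ?thesis
    by (meson antisym order_trans)
qed

lemma seq_m_eq_INF:
  assumes w: "pos_weight_seq w"
    and Q: "seq_m \<phi> w x < \<infinity> \<Longrightarrow> (\<Sum>k. orlicz_term \<phi> (seq_rearr x (Suc k)) (w (2 * Suc k))) < \<infinity>"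
  shows "seq_m \<phi> w x = (INF v\<in>{v. seq_equidistr v w \<and> (\<forall>n\<ge>1. 0 < v n)}. seq_sum \<phi> v x) \<and>
    (INF v\<in>{v. seq_equidistr v w \<and> (\<forall>n\<ge>1. 0 < v n)}. seq_sum \<phi> v x)
      = (INF \<sigma>\<in>{\<sigma>. bij_betw \<sigma> {1..} {1..}}. seq_sum \<phi> (w \<circ> \<sigma>) x)"
    (is "?M = ?V \<and> ?V = ?S")
proof -
  have "?M \<le> ?V"
    using seq_m_le_seq_sum[OF w] by (intro INF_greatest) auto
  moreover have "?V \<le> ?S"
    using automorphism_weight[OF w] by (intro INF_greatest INF_lower) blast
  moreover have "?S \<le> ?M"
  proof (rule ennreal_le_epsilon)
    fix e :: real assume "?M < top" "0 < e"
    then obtain \<sigma> where "bij_betw \<sigma> {1..} {1..}" "seq_sum \<phi> (w \<circ> \<sigma>) x \<le> ?M + 2 * ennreal (e / 2)"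
      using seq_sum_near_optimal[OF w Q, of "ennreal (e / 2)"] by auto
    moreover have "2 * ennreal (e / 2) = ennreal e"
      using \<open>0 < e\<close> ennreal_mult[of 2 "e / 2"] by simp
    ultimately show "?S \<le> ?M + ennreal e"
      by (intro INF_lower2[of \<sigma>]) auto
  qed
  ultimately show ?thesis
    by (meson antisym order_trans)
qed

lemma fun_controlled_finite:
  assumes w: "pos_weight_fun w" and f: "f \<in> L0" and "fun_controlled \<phi> w" and fin: "fun_M \<phi> w f < \<infinity>"
  shows "(\<integral>\<^sup>+t. orlicz_term \<phi> (fun_rearr f t) (w (2 * t)) \<partial>lebesgue_on I) < \<infinity>"
proof -
  obtain K where K: "0 < K" "\<And>c t. 0 < c \<Longrightarrow> 0 < t \<Longrightarrow> \<phi> (c / w (2 * t)) * w (2 * t) \<le> K * (\<phi> (c / w t) * w t)"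
    using assms(3) by (auto simp: fun_controlled_def)
  have [measurable]: "w \<in> L0" "fun_rearr f \<in> borel_measurable (lebesgue_on I)"
    using w f by (auto simp: pos_weight_fun_def L0_antimono_on intro: L0_of_borel measurable_fun_rearr)
  have "(\<integral>\<^sup>+t. orlicz_term \<phi> (fun_rearr f t) (w (2 * t)) \<partial>lebesgue_on I)
      \<le> (\<integral>\<^sup>+t. ennreal K * orlicz_term \<phi> (fun_rearr f t) (w t) \<partial>lebesgue_on I)"
    using K w by (intro nn_integral_mono term_le_controlled) (auto simp: pos_weight_fun_def)
  also have "\<dots> = ennreal K * fun_M \<phi> w f"
    unfolding fun_M_eq using w by (intro nn_integral_cmult measurable_term) (auto simp: pos_weight_fun_def)
  also have "\<dots> < \<infinity>"
    using fin by (simp add: ennreal_mult_less_top)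
  finally show ?thesis .
qed

lemma seq_controlled_finite:
  assumes w: "pos_weight_seq w" and "seq_controlled \<phi> w" and fin: "seq_m \<phi> w x < \<infinity>"
  shows "(\<Sum>k. orlicz_term \<phi> (seq_rearr x (Suc k)) (w (2 * Suc k))) < \<infinity>"
proof -
  obtain K where K: "0 < K" "\<And>c n. 0 < c \<Longrightarrow> 1 \<le> n \<Longrightarrow> \<phi> (c / w (2 * n)) * w (2 * n) \<le> K * (\<phi> (c / w n) * w n)"
    using assms(2) by (auto simp: seq_controlled_def)
  have "(\<Sum>k. orlicz_term \<phi> (seq_rearr x (Suc k)) (w (2 * Suc k)))
      \<le> (\<Sum>k. ennreal K * orlicz_term \<phi> (seq_rearr x (Suc k)) (w (Suc k)))"
  proof (intro suminf_le term_le_controlled)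
    show "\<phi> (c / w (2 * Suc k)) * w (2 * Suc k) \<le> K * (\<phi> (c / w (Suc k)) * w (Suc k))" if "0 < c" for c k
      using that by (rule K(2)) simp
  qed (use K w in \<open>auto simp: pos_weight_seq_def\<close>)
  also have "\<dots> = ennreal K * seq_m \<phi> w x"
    unfolding seq_m_def by (rule ennreal_suminf_cmult)
  also have "\<dots> < \<infinity>"
    using fin by (simp add: ennreal_mult_less_top)
  finally show ?thesis .
qed

text \<open>Substituting \<open>2 * t\<close> for the variable turns \<open>fun_M\<close> of the
  dilation into twice the integral in question.\<close>

lemma fun_D2_finite:
  assumes w: "pos_weight_fun w" and f: "f \<in> L0" and fin: "fun_M \<phi> w (fun_D2 f) < \<infinity>"
  shows "(\<integral>\<^sup>+t. orlicz_term \<phi> (fun_rearr f t) (w (2 * t)) \<partial>lebesgue_on I) < \<infinity>"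
proof -
  obtain w' where [measurable]: "w' \<in> borel_measurable borel" and w': "\<And>t. 0 < w' t" "\<And>t. 0 < t \<Longrightarrow> w' t = w t"
    using weight_borel_extension[OF w] by blast
  have [measurable]: "fun_rearr f \<in> borel_measurable borel"
    using f by (rule measurable_fun_rearr)
  define g where "g t = orlicz_term \<phi> (fun_rearr f t) (w' (2 * t))" for t
  have [measurable]: "g \<in> borel_measurable borel"
    unfolding g_def using w'(1) by measurable
  have "fun_M \<phi> w (fun_D2 f) = (\<integral>\<^sup>+t. g (t / 2) * indicator I t \<partial>lebesgue)"
    unfolding fun_M_def by (intro nn_integral_cong) (auto simp: fun_rearr_D2 g_def w'(2) indicator_def)
  also have "\<dots> = (\<integral>\<^sup>+t. g (t / 2) * indicator I t \<partial>lborel)"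
    by (rule nn_integral_completion)
  also have "\<dots> = ennreal \<bar>2\<bar> * (\<integral>\<^sup>+t. g ((0 + 2 * t) / 2) * indicator I (0 + 2 * t) \<partial>lborel)"
    by (rule nn_integral_real_affine) measurable
  also have "(\<integral>\<^sup>+t. g ((0 + 2 * t) / 2) * indicator I (0 + 2 * t) \<partial>lborel) = (\<integral>\<^sup>+t. g t * indicator I t \<partial>lborel)"
    by (intro nn_integral_cong) (auto simp: indicator_def)
  also have "\<dots> = (\<integral>\<^sup>+t. g t \<partial>lebesgue_on I)"
    by (subst nn_integral_restrict_space) (auto simp: nn_integral_completion)
  also have "\<dots> = (\<integral>\<^sup>+t. orlicz_term \<phi> (fun_rearr f t) (w (2 * t)) \<partial>lebesgue_on I)"
    by (intro nn_integral_cong) (simp add: g_def w'(2))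
  finally show ?thesis
    using fin by (auto simp: ennreal_mult_less_top)
qed

text \<open>The even places of the series for the dilation alone dominate the series in
  question.\<close>

lemma seq_D2_finite:
  assumes w: "pos_weight_seq w" and fin: "seq_m \<phi> w (seq_D2 x) < \<infinity>"
  shows "(\<Sum>k. orlicz_term \<phi> (seq_rearr x (Suc k)) (w (2 * Suc k))) < \<infinity>"
proof -
  let ?b = "\<lambda>n. orlicz_term \<phi> (seq_rearr (seq_D2 x) (Suc n)) (w (Suc n))"
  have "(\<Sum>k. orlicz_term \<phi> (seq_rearr x (Suc k)) (w (2 * Suc k))) \<le> (\<Sum>k. ?b (2 * k + 1))"
  proof (intro suminf_le)
    fix k
    have "orlicz_term \<phi> (seq_rearr x (Suc k)) (w (2 * Suc k)) \<le> orlicz_term \<phi> (seq_rearr (seq_D2 x) (2 * Suc k)) (w (2 * Suc k))"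
      using w by (intro term_mono seq_rearr_D2) (auto simp: pos_weight_seq_def)
    then show "orlicz_term \<phi> (seq_rearr x (Suc k)) (w (2 * Suc k)) \<le> ?b (2 * k + 1)"
      by simp
  qed auto
  also have "\<dots> \<le> (\<Sum>n. ?b n)"
    by (rule suminf_odd_le)
  also have "\<dots> < \<infinity>"
    using fin unfolding seq_m_def .
  finally show ?thesis .
qed

end

theorem theorem2p9:
  fixes \<phi> :: "real \<Rightarrow> real"
  assumes "orlicz_function \<phi>"
  shows
    "(\<forall>w. pos_weight_fun w \<and> fun_controlled \<phi> w \<longrightarrow>
       (\<forall>f\<in>L0.
          fun_M \<phi> w f
            = (INF v\<in>{v \<in> L0. fun_equidistr v w \<and> (\<forall>t\<in>I. 0 < v t)}. fun_integral \<phi> v f) \<and>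
          (INF v\<in>{v \<in> L0. fun_equidistr v w \<and> (\<forall>t\<in>I. 0 < v t)}. fun_integral \<phi> v f)
            = (INF \<sigma>\<in>{\<sigma>. measure_preserving_map \<sigma>}. fun_integral \<phi> (w \<circ> \<sigma>) f))) \<and>
     (\<forall>w. pos_weight_seq w \<and> seq_controlled \<phi> w \<longrightarrow>
       (\<forall>x.
          seq_m \<phi> w x
            = (INF v\<in>{v. seq_equidistr v w \<and> (\<forall>n\<ge>1. 0 < v n)}. seq_sum \<phi> v x) \<and>
          (INF v\<in>{v. seq_equidistr v w \<and> (\<forall>n\<ge>1. 0 < v n)}. seq_sum \<phi> v x)
            = (INF \<sigma>\<in>{\<sigma>. bij_betw \<sigma> {1..} {1..}}. seq_sum \<phi> (w \<circ> \<sigma>) x))) \<and>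
     (\<forall>w. pos_weight_fun w \<longrightarrow>
       (\<forall>f\<in>L0. fun_M \<phi> w (fun_D2 f) < \<infinity> \<longrightarrow>
          fun_M \<phi> w f
            = (INF v\<in>{v \<in> L0. fun_equidistr v w \<and> (\<forall>t\<in>I. 0 < v t)}. fun_integral \<phi> v f) \<and>
          (INF v\<in>{v \<in> L0. fun_equidistr v w \<and> (\<forall>t\<in>I. 0 < v t)}. fun_integral \<phi> v f)
            = (INF \<sigma>\<in>{\<sigma>. measure_preserving_map \<sigma>}. fun_integral \<phi> (w \<circ> \<sigma>) f))) \<and>
     (\<forall>w. pos_weight_seq w \<longrightarrow>
       (\<forall>x. seq_m \<phi> w (seq_D2 x) < \<infinity> \<longrightarrow>
          seq_m \<phi> w x
            = (INF v\<in>{v. seq_equidistr v w \<and> (\<forall>n\<ge>1. 0 < v n)}. seq_sum \<phi> v x) \<and>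
          (INF v\<in>{v. seq_equidistr v w \<and> (\<forall>n\<ge>1. 0 < v n)}. seq_sum \<phi> v x)
            = (INF \<sigma>\<in>{\<sigma>. bij_betw \<sigma> {1..} {1..}}. seq_sum \<phi> (w \<circ> \<sigma>) x)))"
proof -
  interpret orlicz \<phi>
    by unfold_locales fact
  show ?thesis
  proof (rule conjI[OF _ conjI[OF _ conjI]]; intro allI impI ballI; (elim conjE)?)
    fix w f assume "pos_weight_fun w" "fun_controlled \<phi> w" "f \<in> L0"
    then show "fun_M \<phi> w f = (INF v\<in>{v \<in> L0. fun_equidistr v w \<and> (\<forall>t\<in>I. 0 < v t)}. fun_integral \<phi> v f) \<and>
      (INF v\<in>{v \<in> L0. fun_equidistr v w \<and> (\<forall>t\<in>I. 0 < v t)}. fun_integral \<phi> v f)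
        = (INF \<sigma>\<in>{\<sigma>. measure_preserving_map \<sigma>}. fun_integral \<phi> (w \<circ> \<sigma>) f)"
      by (intro fun_M_eq_INF fun_controlled_finite)
  next
    fix w x assume "pos_weight_seq w" "seq_controlled \<phi> w"
    then show "seq_m \<phi> w x = (INF v\<in>{v. seq_equidistr v w \<and> (\<forall>n\<ge>1. 0 < v n)}. seq_sum \<phi> v x) \<and>
      (INF v\<in>{v. seq_equidistr v w \<and> (\<forall>n\<ge>1. 0 < v n)}. seq_sum \<phi> v x)
        = (INF \<sigma>\<in>{\<sigma>. bij_betw \<sigma> {1..} {1..}}. seq_sum \<phi> (w \<circ> \<sigma>) x)"
      by (intro seq_m_eq_INF seq_controlled_finite)
  next
    fix w f assume "pos_weight_fun w" "f \<in> L0" "fun_M \<phi> w (fun_D2 f) < \<infinity>"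
    then show "fun_M \<phi> w f = (INF v\<in>{v \<in> L0. fun_equidistr v w \<and> (\<forall>t\<in>I. 0 < v t)}. fun_integral \<phi> v f) \<and>
      (INF v\<in>{v \<in> L0. fun_equidistr v w \<and> (\<forall>t\<in>I. 0 < v t)}. fun_integral \<phi> v f)
        = (INF \<sigma>\<in>{\<sigma>. measure_preserving_map \<sigma>}. fun_integral \<phi> (w \<circ> \<sigma>) f)"
      by (intro fun_M_eq_INF fun_D2_finite)
  next
    fix w x assume "pos_weight_seq w" "seq_m \<phi> w (seq_D2 x) < \<infinity>"
    then show "seq_m \<phi> w x = (INF v\<in>{v. seq_equidistr v w \<and> (\<forall>n\<ge>1. 0 < v n)}. seq_sum \<phi> v x) \<and>
      (INF v\<in>{v. seq_equidistr v w \<and> (\<forall>n\<ge>1. 0 < v n)}. seq_sum \<phi> v x)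
        = (INF \<sigma>\<in>{\<sigma>. bij_betw \<sigma> {1..} {1..}}. seq_sum \<phi> (w \<circ> \<sigma>) x)"
      by (intro seq_m_eq_INF seq_D2_finite)
  qed
qed

end
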